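(* Let $G=(V,E,m,w)$ be a weighted graph with bounded geometry, and let $x_0\in V$ and $R_0\in\mathbb{N}$. Suppose that $G$ satisfies $\mathrm{CD}(0,\infty)$ outside $B_{R_0}(x_0)$, or that $G$ has nonnegative Ollivier curvature outside $B_{R_0}(x_0)$. Then the number $N^0(G)$ of non-parabolic ends of $G$ is at most $\sharp S_{R_0+1}(x_0)$.
   Context: A weighted graph $G=(V,E,m,w)$ consists of a locally finite, simple, undirected, connected graph $(V,E)$, an edge weight $w:E\to(0,\infty)$, $w(x,y)=w(y,x)$, and a vertex weight $m:V\to(0,\infty)$. We write $x\sim y$ if $\{x,y\}\in E$, $\deg(x)=\sharp\{y: y\sim x\}$, $d$ for the combinatorial graph distance, $B_R(x)=\{y: d(x,y)\le R\}$, $S_R(x)=\{y: d(x,y)=R\}$; $\sharp$ denotes cardinality. Bounded geometry: there is a constant $C>0$ with $\deg(x)\le C$ and $C^{-1}\le m(x)\le C$ for all $x\in V$, and $C^{-1}\le w(x,y)\le C$ for all $x\sim y$. The Laplacian is $\Delta f(x)=\sum_{y\sim x}\frac{w(x,y)}{m(x)}(f(y)-f(x))$. Bakry-Émery condition: put $\Gamma(f,g)=\frac12(\Delta(fg)-f\Delta g-g\Delta f)$, $\Gamma(f)=\Gamma(f,f)$, $\Gamma_2(f)=\frac12\Delta\Gamma(f)-\Gamma(f,\Delta f)$. The curvature $\mathcal{K}^G_\infty(x)$ is the maximal $K$ such that $\Gamma_2(f)(x)\ge K\Gamma(f)(x)$ for all $f:V\to\mathbb{R}$. For a finite $\Omega\subset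 V$, $G$ satisfies $\mathrm{CD}(0,\infty)$ outside $\Omega$ if $\mathcal{K}^G_\infty(x)\ge0$ for all $x\in V\setminus\Omega$. Ollivier curvature: for $x\ne y$ put $\nabla_{xy}f=\frac{f(x)-f(y)}{d(x,y)}$, $|\nabla f|_\infty=\sup_{x\sim y}\nabla_{xy}f$, and $\kappa(x,y)=\inf\{\nabla_{xy}\Delta f:\ f:V\to\mathbb{R},\ \nabla_{yx}f=1,\ |\nabla f|_\infty=1\}$. $G$ has nonnegative Ollivier curvature outside a finite $\Omega$ if $\kappa(x,y)\ge0$ for every edge $\{x,y\}$ with $x,y\in V\setminus\Omega$. Ends: for a finite $\Omega\subset V$, an end of $G$ with respect to $\Omega$ is an infinite connected component $\Pi$ of the subgraph induced on $V\setminus\Omega$. Let $\partial\Pi=\{y\in V\setminus\Pi: d(y,\Pi)=1\}$ and $\overline\Pi=\Pi\cup\partial\Pi$. The end $\Pi$ is non-parabolic if there is $f:\overline\Pi\to(0,\infty)$ with $\Delta f=0$ on $\Pi$, $f=1$ on $\partial\Pi$ and $\liminf_{x\to\infty,\,x\in\Pi}f(x)<1$ (where $x\to\infty$ means $d(x,x_0)\to\infty$ for a fixed vertex $x_0$). Let $N^0_\Omega(G)$ be the number of non-parabolic ends with respect to $\Omega$. The number of non-parabolic ends of $G$ is $N^0(G)=\lim_{i\to\infty}N^0_{\Omega_i}(G)\in\{0,1,2,\dots,\infty\}$ for any exhaustion $\Omega_1\subset\Omega_2\subset\cdots$ of $V$ by finite sets with $\bigcup_i\Omega_i=V$; the limit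 exists and is independent of the exhaustion. *)

theory Defs
  imports Complex_Main "HOL-Library.Extended_Real"
begin

text \<open>
  The vertex set of a graph is the whole type \<open>'v\<close>. The weights are total functions, but
  only the values of the edge weight on adjacent pairs are ever constrained or used.
\<close>

record 'v wgraph =
  adj :: "'v \<Rightarrow> 'v \<Rightarrow> bool"
  vweight :: "'v \<Rightarrow> real"
  eweight :: "'v \<Rightarrow> 'v \<Rightarrow> real"

definition weighted_graph :: "'v wgraph \<Rightarrow> bool" where
  "weighted_graph G \<longleftrightarrow>
     irreflp (adj G) \<and> symp (adj G) \<and>
     (\<forall>x. finite {y. adj G x y}) \<and>
     (\<forall>x y. (adj G)\<^sup>*\<^sup>* x y) \<and>
     (\<forall>x y. adj G x y \<longrightarrow> eweight G x y > 0 \<and> eweight G x y = eweight G y x) \<and>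
     (\<forall>x. vweight G x > 0)"

definition degree :: "'v wgraph \<Rightarrow> 'v \<Rightarrow> nat" where
  "degree G x = card {y. adj G x y}"

definition bounded_geometry :: "'v wgraph \<Rightarrow> bool" where
  "bounded_geometry G \<longleftrightarrow>
     (\<exists>C>0. (\<forall>x. real (degree G x) \<le> C \<and> inverse C \<le> vweight G x \<and> vweight G x \<le> C) \<and>
            (\<forall>x y. adj G x y \<longrightarrow> inverse C \<le> eweight G x y \<and> eweight G x y \<le> C))"

text \<open>Length of a shortest walk; meaningful since the graphs considered are connected.\<close>

definition gdist :: "'v wgraph \<Rightarrow> 'v \<Rightarrow> 'v \<Rightarrow> nat" where
  "gdist G x y = (LEAST n. (adj G ^^ n) x y)"

definition graph_ball :: "'v wgraph \<Rightarrow> 'v \<Rightarrow> nat \<Rightarrow> 'v set" where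
  "graph_ball G x R = {y. gdist G x y \<le> R}"

definition graph_sphere :: "'v wgraph \<Rightarrow> 'v \<Rightarrow> nat \<Rightarrow> 'v set" where
  "graph_sphere G x R = {y. gdist G x y = R}"

definition laplacian :: "'v wgraph \<Rightarrow> ('v \<Rightarrow> real) \<Rightarrow> 'v \<Rightarrow> real" where
  "laplacian G f x = (\<Sum>y | adj G x y. eweight G x y / vweight G x * (f y - f x))"


subsection \<open>Bakry-Emery curvature\<close>

definition Gam :: "'v wgraph \<Rightarrow> ('v \<Rightarrow> real) \<Rightarrow> ('v \<Rightarrow> real) \<Rightarrow> 'v \<Rightarrow> real" where
  "Gam G f g x =
     (laplacian G (\<lambda>z. f z * g z) x - f x * laplacian G g x - g x * laplacian G f x) / 2"

definition Gam2 :: "'v wgraph \<Rightarrow> ('v \<Rightarrow> real) \<Rightarrow> 'v \<Rightarrow> real" where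
  "Gam2 G f x = laplacian G (Gam G f f) x / 2 - Gam G f (laplacian G f) x"

text \<open>
  The admissible constants \<open>K\<close> form a closed, downward closed set of reals, so the supremum is
  the maximum. It is taken in the extended reals only because every \<open>K\<close> is admissible
  in the graph with a single vertex.
\<close>

definition bakry_emery_curvature :: "'v wgraph \<Rightarrow> 'v \<Rightarrow> ereal" where
  "bakry_emery_curvature G x =
     Sup (ereal ` {K. \<forall>f. Gam2 G f x \<ge> K * Gam G f f x})"

definition CD_0_inf_outside :: "'v wgraph \<Rightarrow> 'v set \<Rightarrow> bool" where
  "CD_0_inf_outside G \<Omega> \<longleftrightarrow> (\<forall>x. x \<notin> \<Omega> \<longrightarrow> bakry_emery_curvature G x \<ge> 0)"


subsection \<open>Ollivier curvature\<close>

definition grad :: "'v wgraph \<Rightarrow> 'v \<Rightarrow> 'v \<Rightarrow> ('v \<Rightarrow> real) \<Rightarrow> real" where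
  "grad G x y f = (f x - f y) / real (gdist G x y)"

text \<open>Extended-real valued, since functions with unbounded gradient must not satisfy
  \<open>grad_sup G f = 1\<close>.\<close>

definition grad_sup :: "'v wgraph \<Rightarrow> ('v \<Rightarrow> real) \<Rightarrow> ereal" where
  "grad_sup G f = (SUP (x, y) \<in> {(x, y). adj G x y}. ereal (grad G x y f))"

definition ollivier_curvature :: "'v wgraph \<Rightarrow> 'v \<Rightarrow> 'v \<Rightarrow> ereal" where
  "ollivier_curvature G x y =
     (INF f \<in> {f. grad G y x f = 1 \<and> grad_sup G f = 1}. ereal (grad G x y (laplacian G f)))"

definition nonneg_ollivier_outside :: "'v wgraph \<Rightarrow> 'v set \<Rightarrow> bool" where
  "nonneg_ollivier_outside G \<Omega> \<longleftrightarrow>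
     (\<forall>x y. adj G x y \<and> x \<notin> \<Omega> \<and> y \<notin> \<Omega> \<longrightarrow> ollivier_curvature G x y \<ge> 0)"


subsection \<open>Ends\<close>

definition induced_components :: "'v wgraph \<Rightarrow> 'v set \<Rightarrow> 'v set set" where
  "induced_components G U =
     {{y. (\<lambda>a b. adj G a b \<and> a \<in> U \<and> b \<in> U)\<^sup>*\<^sup>* x y} | x. x \<in> U}"

definition graph_ends :: "'v wgraph \<Rightarrow> 'v set \<Rightarrow> 'v set set" where
  "graph_ends G \<Omega> = {\<Pi> \<in> induced_components G (- \<Omega>). infinite \<Pi>}"

definition outer_boundary :: "'v wgraph \<Rightarrow> 'v set \<Rightarrow> 'v set" where
  "outer_boundary G \<Pi> = {y. y \<notin> \<Pi> \<and> (INF p\<in>\<Pi>. gdist G y p) = 1}"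

text \<open>The filter of \<open>x \<rightarrow> \<infinity>\<close>, that is, of \<open>d(x, x0) \<rightarrow> \<infinity>\<close>.\<close>

definition vertex_infinity :: "'v wgraph \<Rightarrow> 'v \<Rightarrow> 'v filter" where
  "vertex_infinity G x0 = filtercomap (\<lambda>x. gdist G x x0) at_top"

lemma walk_triangle:
  assumes "weighted_graph G"
  shows "gdist G x z \<le> gdist G x y + gdist G y z"
proof -
  have walk: "(adj G ^^ gdist G a b) a b" for a b
  proof -
    have "\<exists>n. (adj G ^^ n) a b"
      using assms by (simp add: weighted_graph_def rtranclp_power)
    then show ?thesis
      unfolding gdist_def by (rule LeastI_ex)
  qed
  have "(adj G ^^ (gdist G x y + gdist G y z)) x z"
    using walk[of x y] walk[of y z] by (auto simp: relpowp_add)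
  then show ?thesis
    unfolding gdist_def by (rule Least_le)
qed

lemma vertex_infinity_le:
  assumes "weighted_graph G"
  shows "vertex_infinity G a \<le> vertex_infinity G b"
proof -
  have "filterlim (\<lambda>x. gdist G x b) at_top (vertex_infinity G a)"
    unfolding filterlim_at_top
  proof
    fix N
    have "eventually (\<lambda>x. gdist G x a \<ge> N + gdist G b a) (vertex_infinity G a)"
      unfolding vertex_infinity_def
      by (rule eventually_filtercomapI) (rule eventually_ge_at_top)
    then show "eventually (\<lambda>x. N \<le> gdist G x b) (vertex_infinity G a)"
    proof (rule eventually_mono)
      fix x assume "N + gdist G b a \<le> gdist G x a"
      then show "N \<le> gdist G x b"
        using walk_triangle[OF assms, of x a b] by linarith
    qed
  qed
  then show ?thesis
    by (simp add: vertex_infinity_def filterlim_iff_le_filtercomap)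
qed

text \<open>The choice of the base vertex does not matter.\<close>

lemma vertex_infinity_base:
  "weighted_graph G \<Longrightarrow> vertex_infinity G a = vertex_infinity G b"
  by (simp add: vertex_infinity_le antisym)

text \<open>
  For \<open>\<Pi>\<close> an end, the Laplacian on \<open>\<Pi>\<close> involves only values of \<open>f\<close> on
  \<open>\<Pi> \<union> outer_boundary G \<Pi>\<close>, so a total \<open>f\<close> is no restriction.
\<close>

definition nonparabolic :: "'v wgraph \<Rightarrow> 'v set \<Rightarrow> bool" where
  "nonparabolic G \<Pi> \<longleftrightarrow>
     (\<exists>f :: 'v \<Rightarrow> real.
        (\<forall>x \<in> \<Pi> \<union> outer_boundary G \<Pi>. f x > 0) \<and>
        (\<forall>x \<in> \<Pi>. laplacian G f x = 0) \<and>
        (\<forall>x \<in> outer_boundary G \<Pi>. f x = 1) \<and>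
        (\<exists>x0. Liminf (inf (vertex_infinity G x0) (principal \<Pi>)) (\<lambda>x. ereal (f x)) < 1))"

definition ecount :: "'b set \<Rightarrow> enat" where
  "ecount A = (if finite A then enat (card A) else \<infinity>)"

definition num_nonparabolic_ends_wrt :: "'v wgraph \<Rightarrow> 'v set \<Rightarrow> enat" where
  "num_nonparabolic_ends_wrt G \<Omega> = ecount {\<Pi> \<in> graph_ends G \<Omega>. nonparabolic G \<Pi>}"

definition exhaustion :: "(nat \<Rightarrow> 'v set) \<Rightarrow> bool" where
  "exhaustion \<Omega> \<longleftrightarrow> incseq \<Omega> \<and> (\<forall>i. finite (\<Omega> i)) \<and> (\<Union>i. \<Omega> i) = UNIV"

text \<open>The common limit, in the order topology of \<open>enat\<close>, along all exhaustions.\<close>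

definition num_nonparabolic_ends :: "'v wgraph \<Rightarrow> enat" where
  "num_nonparabolic_ends G =
     (THE N. \<forall>\<Omega>. exhaustion \<Omega> \<longrightarrow>
        (\<lambda>i. num_nonparabolic_ends_wrt G (\<Omega> i)) \<longlonglongrightarrow> N)"

end

theory Submission imports Defs begin

text \<open>
  The bound comes from counting bounded harmonic functions. Each non-parabolic end with respect to a
  finite set carries a superharmonic function with values between \<open>0\<close> and \<open>1\<close> that is \<open>1\<close> off the end
  and comes arbitrarily close to \<open>0\<close> on it (a barrier). The greatest harmonic minorants of these
  barriers, subtracted from \<open>1\<close>, are linearly independent bounded harmonic functions
  (\<open>barriers_independent\<close>). If there were more ends than vertices in the sphere of radius \<open>R + 1\<close>,
  some nontrivial linear combination \<open>u\<close> would vanish on this sphere, hence, by the maximum principle,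
  on the whole ball of radius \<open>R + 1\<close>. So \<open>u\<close> varies only along edges with both endpoints outside the
  ball of radius \<open>R\<close>, where the curvature is nonnegative, and it remains to see that \<open>u\<close> is constant
  (\<open>harmonic_eq_0\<close>).

  Under the Bakry-Emery condition, \<open>\<Gamma>(u)\<close> is subharmonic outside the ball by Bochner's formula and
  inside it because it is \<open>0\<close> there. The Laplacian of \<open>u\<^sup>2\<close> is \<open>2 \<Gamma>(u)\<close>, so in \<open>n\<close> steps of a lazy
  random walk the expectation of \<open>u\<^sup>2\<close> grows by at least \<open>n\<close> times a fixed multiple of \<open>\<Gamma>(u)\<close>. As \<open>u\<close> is
  bounded, \<open>\<Gamma>(u) = 0\<close>.

  Under the Ollivier condition, suppose that the Lipschitz constant of \<open>u\<close> is positive, and consider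
  an edge on which it is almost attained. Testing the curvature with a small perturbation of \<open>u\<close>
  at a single vertex yields another such edge whose upper endpoint has a value larger by a
  definite amount (\<open>ollivier_ascent\<close>). The loss in the gradient is a constant factor in each step,
  so starting close enough to the Lipschitz constant one can climb arbitrarily high, which
  contradicts boundedness.

  Finally, for an end with respect to a nonempty finite set, non-parabolicity is equivalent to the
  existence of a barrier. A barrier is inherited by some component of the end when the finite set grows, so the number of non-parabolic
  ends is monotone in the finite set, and its limit along any exhaustion is its supremum over the
  nonempty finite sets.
\<close>

section \<open>Walks, distances and balls\<close>

locale connected_wgraph =
  fixes G :: "'v wgraph"
  assumes weighted_graph: "weighted_graph G"
begin

lemma adj_sym: "adj G x y \<Longrightarrow> adj G y x"
  using weighted_graph by (auto simp: weighted_graph_def symp_def)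

lemma adj_irrefl: "\<not> adj G x x"
  using weighted_graph by (auto simp: weighted_graph_def irreflp_def)

lemma finite_neighbours [simp]: "finite {y. adj G x y}"
  using weighted_graph by (auto simp: weighted_graph_def)

lemma rate_pos: "adj G x y \<Longrightarrow> 0 < eweight G x y / vweight G x"
  using weighted_graph by (auto simp: weighted_graph_def)

lemma rate_sum_mono:
  assumes "S \<subseteq> {y. adj G x y}" and "\<And>y. y \<in> S \<Longrightarrow> f y \<le> g y"
  shows "(\<Sum>y\<in>S. eweight G x y / vweight G x * f y) \<le> (\<Sum>y\<in>S. eweight G x y / vweight G x * g y)"
proof (rule sum_mono)
  fix y assume y: "y \<in> S"
  then have "0 \<le> eweight G x y / vweight G x"
    using assms(1) rate_pos[of x y] by auto
  then show "eweight G x y / vweight G x * f y \<le> eweight G x y / vweight G x * g y"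
    using assms(2)[OF y] by (rule mult_left_mono[rotated])
qed

lemma closed_under_adj_UNIV:
  assumes "P a" and "\<And>x y. P x \<Longrightarrow> adj G x y \<Longrightarrow> P y"
  shows "P b"
proof -
  have "(adj G)\<^sup>*\<^sup>* a b"
    using weighted_graph by (auto simp: weighted_graph_def)
  then show ?thesis
    by (induction rule: rtranclp_induct) (use assms in auto)
qed

lemma walk_gdist: "(adj G ^^ gdist G a b) a b"
proof -
  have "\<exists>n. (adj G ^^ n) a b"
    using weighted_graph by (simp add: weighted_graph_def rtranclp_power)
  then show ?thesis
    unfolding gdist_def by (rule LeastI_ex)
qed

lemma gdist_le: "(adj G ^^ n) a b \<Longrightarrow> gdist G a b \<le> n"
  unfolding gdist_def by (rule Least_le)

lemma gdist_eq_0_iff: "gdist G a b = 0 \<longleftrightarrow> a = b"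
  using walk_gdist[of a b] gdist_le[of 0 a b] by auto

lemma gdist_eq_1_iff: "gdist G a b = 1 \<longleftrightarrow> adj G a b"
proof
  assume "gdist G a b = 1"
  then show "adj G a b"
    using walk_gdist[of a b] by (auto simp: OO_def)
next
  assume ab: "adj G a b"
  then have "gdist G a b \<le> 1"
    by (intro gdist_le) (auto simp: OO_def)
  moreover have "gdist G a b \<noteq> 0"
    using ab adj_irrefl by (auto simp: gdist_eq_0_iff)
  ultimately show "gdist G a b = 1"
    by simp
qed

lemma walk_sym: "(adj G ^^ n) a b \<Longrightarrow> (adj G ^^ n) b a"
proof (induction n arbitrary: b)
  case (Suc n)
  then obtain c where "(adj G ^^ n) a c" "adj G c b"
    by auto
  then have "(adj G ^^ n) c a" "adj G b c"
    using Suc.IH adj_sym by auto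
  then show ?case
    by (rule relpowp_Suc_I2[rotated])
qed auto

lemma gdist_commute: "gdist G a b = gdist G b a"
  by (meson antisym gdist_le walk_sym walk_gdist)

lemma gdist_adj_le: "adj G y z \<Longrightarrow> gdist G x z \<le> gdist G x y + 1"
  using walk_triangle[OF weighted_graph, of x z y] gdist_eq_1_iff[of y z] by simp

lemma finite_graph_ball: "finite (graph_ball G x R)"
proof (induction R)
  case 0
  have "graph_ball G x 0 = {x}"
    by (auto simp: graph_ball_def gdist_eq_0_iff)
  then show ?case
    by simp
next
  case (Suc R)
  have "graph_ball G x (Suc R) \<subseteq> graph_ball G x R \<union> (\<Union>z\<in>graph_ball G x R. {y. adj G z y})"
  proof
    fix y assume "y \<in> graph_ball G x (Suc R)"
    then have y: "gdist G x y \<le> Suc R"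
      by (simp add: graph_ball_def)
    show "y \<in> graph_ball G x R \<union> (\<Union>z\<in>graph_ball G x R. {y. adj G z y})"
    proof (cases "gdist G x y")
      case (Suc n)
      then obtain z where z: "(adj G ^^ n) x z" "adj G z y"
        using walk_gdist[of x y] by auto
      have "gdist G x z \<le> R"
        using gdist_le[OF z(1)] Suc y by simp
      then show ?thesis
        using z(2) by (auto simp: graph_ball_def)
    qed (auto simp: graph_ball_def)
  qed
  then show ?case
    by (rule finite_subset) (use Suc in auto)
qed

lemma finite_graph_sphere: "finite (graph_sphere G x R)"
  by (rule finite_subset[OF _ finite_graph_ball[of x R]])
    (auto simp: graph_sphere_def graph_ball_def)

lemma lipschitz_gdist:
  fixes f :: "'v \<Rightarrow> real"
  assumes "\<And>a b. adj G a b \<Longrightarrow> f b - f a \<le> 1"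
  shows "f v \<le> f x + real (gdist G x v)"
proof -
  have "(adj G ^^ n) x v \<Longrightarrow> f v \<le> f x + real n" for n
  proof (induction n arbitrary: v)
    case (Suc n)
    then obtain c where c: "(adj G ^^ n) x c" "adj G c v"
      by auto
    show ?case
      using Suc.IH[OF c(1)] assms[OF c(2)] by simp
  qed auto
  then show ?thesis
    using walk_gdist by blast
qed

lemma outer_boundary_iff:
  assumes "\<Pi> \<noteq> {}"
  shows "y \<in> outer_boundary G \<Pi> \<longleftrightarrow> y \<notin> \<Pi> \<and> (\<exists>p\<in>\<Pi>. adj G y p)"
proof -
  have "(INF p\<in>\<Pi>. gdist G y p) = 1 \<longleftrightarrow> (\<exists>p\<in>\<Pi>. adj G y p)" if "y \<notin> \<Pi>"
  proof
    assume "(INF p\<in>\<Pi>. gdist G y p) = 1"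
    then have "1 \<in> gdist G y ` \<Pi>"
      using Inf_nat_def1[of "gdist G y ` \<Pi>"] assms by auto
    then show "\<exists>p\<in>\<Pi>. adj G y p"
      by (metis gdist_eq_1_iff imageE)
  next
    assume "\<exists>p\<in>\<Pi>. adj G y p"
    then obtain p where p: "p \<in> \<Pi>" "gdist G y p = 1"
      using gdist_eq_1_iff by blast
    show "(INF p\<in>\<Pi>. gdist G y p) = 1"
    proof (rule cInf_eq_minimum)
      show "1 \<in> gdist G y ` \<Pi>"
        using p by (metis imageI)
      show "1 \<le> k" if "k \<in> gdist G y ` \<Pi>" for k
        using that \<open>y \<notin> \<Pi>\<close> gdist_eq_0_iff
        by (metis One_nat_def Suc_leI imageE not_gr_zero)
    qed
  qed
  then show ?thesis
    by (auto simp: outer_boundary_def)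
qed


section \<open>The Laplacian and the minimum principle\<close>

lemma laplacian_add: "laplacian G (\<lambda>x. f x + g x) x = laplacian G f x + laplacian G g x"
  unfolding laplacian_def sum.distrib[symmetric]
  by (rule sum.cong) (auto simp: algebra_simps add_divide_distrib diff_divide_distrib)

lemma laplacian_affine: "laplacian G (\<lambda>x. a * f x + b) x = a * laplacian G f x"
  unfolding laplacian_def sum_distrib_left
  by (rule sum.cong) (auto simp: algebra_simps diff_divide_distrib)

lemma laplacian_cmult: "laplacian G (\<lambda>x. a * f x) x = a * laplacian G f x"
  using laplacian_affine[of a f 0 x] by simp

lemma laplacian_const: "laplacian G (\<lambda>x. c) x = 0"
  by (simp add: laplacian_def)

lemma laplacian_sum:
  "laplacian G (\<lambda>x. \<Sum>i\<in>I. c i * f i x) x = (\<Sum>i\<in>I. c i * laplacian G (f i) x)"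
proof -
  have "laplacian G (\<lambda>x. \<Sum>i\<in>I. c i * f i x) x =
      (\<Sum>y | adj G x y. \<Sum>i\<in>I. c i * (eweight G x y / vweight G x * (f i y - f i x)))"
    unfolding laplacian_def sum_subtractf[symmetric] sum_distrib_left
    by (intro sum.cong refl) (simp add: algebra_simps diff_divide_distrib)
  also have "\<dots> = (\<Sum>i\<in>I. c i * laplacian G (f i) x)"
    unfolding laplacian_def sum_distrib_left by (rule sum.swap)
  finally show ?thesis .
qed

lemma laplacian_mono_at:
  assumes "\<And>y. adj G x y \<Longrightarrow> f y - f x \<le> g y - g x"
  shows "laplacian G f x \<le> laplacian G g x"
  unfolding laplacian_def
  by (rule rate_sum_mono) (use assms in auto)

lemma superharmonic_at_min_neighbour:
  assumes "laplacian G v x \<le> 0" and "\<And>y. adj G x y \<Longrightarrow> v x \<le> v y" and "adj G x y"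
  shows "v y = v x"
proof -
  let ?t = "\<lambda>y. eweight G x y / vweight G x * (v y - v x)"
  have nonneg: "0 \<le> ?t y" if "adj G x y" for y
    using assms(2)[OF that] rate_pos[OF that] by (intro mult_nonneg_nonneg) auto
  then have "(\<Sum>y | adj G x y. ?t y) = 0"
    using assms(1) sum_nonneg[of "{y. adj G x y}" ?t] by (auto simp: laplacian_def)
  then have "?t y = 0"
    using nonneg assms(3) by (subst (asm) sum_nonneg_eq_0_iff) auto
  then show ?thesis
    using rate_pos[OF assms(3)] by (metis eq_iff_diff_eq_0 mult_eq_0_iff less_irrefl)
qed

lemma superharmonic_pos:
  assumes "\<And>x. 0 \<le> v x" and "\<And>x. laplacian G v x \<le> 0" and "0 < v a"
  shows "0 < v x"
proof (rule ccontr)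
  assume "\<not> 0 < v x"
  then have "v x = 0"
    using assms(1)[of x] by simp
  then have "v a = 0"
  proof (rule closed_under_adj_UNIV)
    show "v z = 0" if "v y = 0" "adj G y z" for y z
      using superharmonic_at_min_neighbour[of v y z] that assms(1,2) by simp
  qed
  then show False
    using assms(3) by simp
qed

text \<open>
  Capping at \<open>1\<close> and extending by \<open>1\<close> turns a function that is superharmonic only on \<open>\<Pi>\<close> into one
  that is superharmonic everywhere, provided it is at least \<open>1\<close> on the boundary of \<open>\<Pi>\<close>.
\<close>

lemma superharmonic_cap:
  fixes f :: "'v \<Rightarrow> real"
  assumes super: "\<And>x. x \<in> \<Pi> \<Longrightarrow> laplacian G f x \<le> 0"
    and boundary: "\<And>x y. x \<in> \<Pi> \<Longrightarrow> adj G x y \<Longrightarrow> y \<notin> \<Pi> \<Longrightarrow> 1 \<le> f y"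
  shows "laplacian G (\<lambda>x. if x \<in> \<Pi> then min (f x) 1 else 1) x \<le> 0"
proof -
  define v where "v = (\<lambda>x. if x \<in> \<Pi> then min (f x) 1 else 1)"
  have v1: "v y \<le> 1" for y
    by (simp add: v_def)
  have "laplacian G v x \<le> 0"
  proof (cases "x \<in> \<Pi> \<and> f x \<le> 1")
    case True
    have "laplacian G v x \<le> laplacian G f x"
    proof (rule laplacian_mono_at)
      fix y assume "adj G x y"
      then show "v y - v x \<le> f y - f x"
        using True boundary[of x y] by (auto simp: v_def)
    qed
    then show ?thesis
      using super[of x] True by simp
  next
    case False
    then have "v x = 1"
      by (auto simp: v_def)
    then have "laplacian G v x \<le> laplacian G (\<lambda>x. 1) x"
      by (intro laplacian_mono_at) (use v1 in auto)
    then show ?thesis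
      by (simp add: laplacian_const)
  qed
  then show ?thesis
    by (simp add: v_def)
qed

lemma harmonic_vanishing_on_sphere:
  assumes harm: "\<And>x. laplacian G u x = 0"
    and zero: "\<And>x. x \<in> graph_sphere G x0 (R + 1) \<Longrightarrow> u x = 0"
    and inf: "infinite (UNIV :: 'v set)"
    and x: "x \<in> graph_ball G x0 (R + 1)"
  shows "u x = 0"
proof -
  have nonneg: "0 \<le> u x" if harm: "\<And>x. laplacian G u x = 0"
    and zero: "\<And>x. x \<in> graph_sphere G x0 (R + 1) \<Longrightarrow> u x = 0"
    for u :: "'v \<Rightarrow> real"
  proof (rule ccontr)
    assume neg: "\<not> 0 \<le> u x"
    let ?B = "graph_ball G x0 (R + 1)"
    define m where "m = Min (u ` ?B)"
    have m_le: "m \<le> u y" if "y \<in> ?B" for y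
      unfolding m_def using that finite_graph_ball by (intro Min_le) auto
    have "m \<in> u ` ?B"
      unfolding m_def using x finite_graph_ball by (intro Min_in) auto
    then obtain a where a: "a \<in> ?B" "u a = m"
      by auto
    have m_neg: "m < 0"
      using m_le[OF x] neg by simp
    have inner: "y \<in> graph_ball G x0 R" if "y \<in> ?B" "u y = m" for y
      using that zero[of y] m_neg by (auto simp: graph_ball_def graph_sphere_def le_Suc_eq)
    have "b \<in> graph_ball G x0 R \<and> u b = m" for b
    proof (rule closed_under_adj_UNIV[of _ a])
      fix y z assume y: "y \<in> graph_ball G x0 R \<and> u y = m" and yz: "adj G y z"
      have nb: "w \<in> ?B" if "adj G y w" for w
        using y gdist_adj_le[OF that, of x0] by (auto simp: graph_ball_def)
      have "u z = u y"
        by (rule superharmonic_at_min_neighbour) (use yz y harm nb m_le in auto)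
      then show "z \<in> graph_ball G x0 R \<and> u z = m"
        using y inner[OF nb[OF yz]] by simp
    qed (use a inner in auto)
    then have "(UNIV :: 'v set) \<subseteq> graph_ball G x0 R"
      by auto
    then show False
      using inf finite_graph_ball finite_subset by blast
  qed
  have "laplacian G (\<lambda>x. - u x) x = 0" for x
    using laplacian_cmult[of "-1" u x] harm by simp
  then have "0 \<le> - u x"
    by (rule nonneg) (use zero in auto)
  moreover have "0 \<le> u x"
    by (rule nonneg) (use harm zero in auto)
  ultimately show ?thesis
    by simp
qed


section \<open>Components of the complement of a finite set\<close>

lemma component_subset:
  assumes "C \<in> induced_components G U"
  shows "C \<subseteq> U"
proof
  fix y assume y: "y \<in> C"
  obtain a where a: "a \<in> U" "C = {y. (\<lambda>a b. adj G a b \<and> a \<in> U \<and> b \<in> U)\<^sup>*\<^sup>* a y}"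
    using assms by (auto simp: induced_components_def)
  then have "(\<lambda>a b. adj G a b \<and> a \<in> U \<and> b \<in> U)\<^sup>*\<^sup>* a y"
    using y by simp
  then show "y \<in> U"
    by (induction rule: rtranclp_induct) (use a(1) in auto)
qed

lemma component_eq:
  assumes "C \<in> induced_components G U" and "x \<in> C"
  shows "C = {y. (\<lambda>a b. adj G a b \<and> a \<in> U \<and> b \<in> U)\<^sup>*\<^sup>* x y}"
proof -
  define r where "r a b \<longleftrightarrow> adj G a b \<and> a \<in> U \<and> b \<in> U" for a b
  obtain a where a: "C = {y. r\<^sup>*\<^sup>* a y}"
    using assms(1) by (auto simp: induced_components_def r_def[abs_def])
  have "symp r"
    using adj_sym by (auto simp: symp_def r_def)
  then have sym: "symp r\<^sup>*\<^sup>*"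
    by (rule symp_rtranclp)
  have ax: "r\<^sup>*\<^sup>* a x"
    using assms(2) a by simp
  have xa: "r\<^sup>*\<^sup>* x a"
    using sympD[OF sym ax] .
  have "r\<^sup>*\<^sup>* a y \<longleftrightarrow> r\<^sup>*\<^sup>* x y" for y
    using rtranclp_trans[OF ax, of y] rtranclp_trans[OF xa, of y] by blast
  then show ?thesis
    using a by (simp add: r_def[abs_def])
qed

lemma component_adj:
  assumes "C \<in> induced_components G U" and "x \<in> C" and "adj G x y" and "y \<in> U"
  shows "y \<in> C"
proof -
  have "x \<in> U"
    using assms component_subset by blast
  then show ?thesis
    using component_eq[OF assms(1,2)] assms(3,4) by auto
qed

lemma components_disjoint:
  assumes "C \<in> induced_components G U" and "D \<in> induced_components G U" and "x \<in> C" and "x \<in> D"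
  shows "C = D"
  using component_eq[OF assms(1,3)] component_eq[OF assms(2,4)] by simp

lemma component_mono:
  assumes "C \<in> induced_components G U" and "D \<in> induced_components G W"
    and "U \<subseteq> W" and "x \<in> C" and "x \<in> D"
  shows "C \<subseteq> D"
proof -
  have "(\<lambda>a b. adj G a b \<and> a \<in> U \<and> b \<in> U)\<^sup>*\<^sup>* \<le> (\<lambda>a b. adj G a b \<and> a \<in> W \<and> b \<in> W)\<^sup>*\<^sup>*"
    by (rule rtranclp_mono) (use assms(3) in auto)
  then show ?thesis
    using component_eq[OF assms(1,4)] component_eq[OF assms(2,5)] by auto
qed

lemma ex_component:
  assumes "x \<in> U"
  shows "\<exists>C\<in>induced_components G U. x \<in> C"
proof
  let ?C = "{y. (\<lambda>a b. adj G a b \<and> a \<in> U \<and> b \<in> U)\<^sup>*\<^sup>* x y}"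
  show "?C \<in> induced_components G U"
    using assms by (auto simp: induced_components_def)
  show "x \<in> ?C"
    by simp
qed

lemma finite_components:
  assumes "finite \<Omega>" and "\<Omega> \<noteq> {}"
  shows "finite (induced_components G (- \<Omega>))"
proof -
  let ?comp = "\<lambda>x. {y. (\<lambda>a b. adj G a b \<and> a \<in> - \<Omega> \<and> b \<in> - \<Omega>)\<^sup>*\<^sup>* x y}"
  have "induced_components G (- \<Omega>) \<subseteq> ?comp ` (\<Union>z\<in>\<Omega>. {y. adj G z y})"
  proof
    fix C assume C: "C \<in> induced_components G (- \<Omega>)"
    then obtain a where a: "a \<in> C"
      by (auto simp: induced_components_def)
    obtain z where z: "z \<in> \<Omega>"
      using assms by auto
    \<comment> \<open>By connectedness of the graph, some edge leaves \<open>C\<close>; it must end in \<open>\<Omega>\<close>.\<close>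
    have "\<exists>x y. x \<in> C \<and> adj G x y \<and> y \<notin> C"
    proof (rule ccontr)
      assume "\<nexists>x y. x \<in> C \<and> adj G x y \<and> y \<notin> C"
      then have "z \<in> C"
        using closed_under_adj_UNIV[of "\<lambda>x. x \<in> C" a z] a by blast
      then show False
        using component_subset[OF C] z by auto
    qed
    then obtain x y where xy: "x \<in> C" "adj G x y" "y \<notin> C"
      by auto
    have "y \<in> \<Omega>"
      using component_adj[OF C xy(1,2)] xy(3) by auto
    then have "x \<in> (\<Union>z\<in>\<Omega>. {y. adj G z y})"
      using adj_sym[OF xy(2)] by auto
    moreover have "C = ?comp x"
      by (rule component_eq[OF C xy(1)])
    ultimately show "C \<in> ?comp ` (\<Union>z\<in>\<Omega>. {y. adj G z y})"
      by blast
  qed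
  then show ?thesis
    by (rule finite_subset) (use assms in auto)
qed

end


section \<open>Harmonic minorants\<close>

text \<open>
  The constant \<open>A\<close> bounds the vertex degrees and the transition rates from above and the
  transition rates from below.
\<close>

locale bounded_wgraph = connected_wgraph G for G :: "'v wgraph" +
  fixes A :: real
  assumes A_ge_1: "1 \<le> A"
    and degree_le: "real (card {y. adj G x y}) \<le> A"
    and rate_le: "adj G x y \<Longrightarrow> eweight G x y / vweight G x \<le> A"
    and rate_ge: "adj G x y \<Longrightarrow> 1 / A \<le> eweight G x y / vweight G x"
begin

lemma total_rate_le:
  assumes "S \<subseteq> {y. adj G x y}"
  shows "(\<Sum>y\<in>S. eweight G x y / vweight G x) \<le> A\<^sup>2"
proof -
  have "(\<Sum>y\<in>S. eweight G x y / vweight G x) \<le> (\<Sum>y\<in>S. A)"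
    by (rule sum_mono) (use assms rate_le in auto)
  also have "\<dots> = real (card S) * A"
    by simp
  also have "\<dots> \<le> A * A"
  proof (rule mult_right_mono)
    have "real (card S) \<le> real (card {y. adj G x y})"
      using assms by (simp add: card_mono)
    then show "real (card S) \<le> A"
      using degree_le[of x] by simp
  qed (use A_ge_1 in auto)
  finally show ?thesis
    by (simp add: power2_eq_square)
qed

text \<open>
  One step of a lazy random walk that is stopped outside \<open>U\<close>. The step size makes the total
  probability of moving at most \<open>1\<close> at every vertex, so the operator is monotone.
\<close>

definition relax :: "'v set \<Rightarrow> ('v \<Rightarrow> real) \<Rightarrow> 'v \<Rightarrow> real" where
  "relax U f x = (if x \<in> U then f x + laplacian G f x / A\<^sup>2 else f x)"

lemma relax_mono:
  assumes "\<And>x. f x \<le> g x"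
  shows "relax U f x \<le> relax U g x"
proof -
  let ?p = "\<lambda>y. eweight G x y / vweight G x"
  let ?D = "\<Sum>y | adj G x y. ?p y"
  have expand: "h x + laplacian G h x / A\<^sup>2
      = (1 - ?D / A\<^sup>2) * h x + (\<Sum>y | adj G x y. ?p y * h y) / A\<^sup>2" for h
  proof -
    have "laplacian G h x = (\<Sum>y | adj G x y. ?p y * h y) - ?D * h x"
      by (simp only: laplacian_def right_diff_distrib sum_subtractf sum_distrib_right)
    then show ?thesis
      by (simp only: diff_divide_distrib left_diff_distrib times_divide_eq_left mult_1_left)
  qed
  have "?D / A\<^sup>2 \<le> 1"
    using total_rate_le[of "{y. adj G x y}" x] A_ge_1 by (simp add: divide_le_eq_1)
  then have "(1 - ?D / A\<^sup>2) * f x \<le> (1 - ?D / A\<^sup>2) * g x"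
    using assms by (intro mult_left_mono) auto
  moreover have "(\<Sum>y | adj G x y. ?p y * f y) \<le> (\<Sum>y | adj G x y. ?p y * g y)"
    by (rule rate_sum_mono) (use assms in auto)
  ultimately show ?thesis
    using assms unfolding relax_def expand by (auto intro!: add_mono divide_right_mono)
qed

lemma greatest_harmonic_minorant:
  fixes v :: "'v \<Rightarrow> real"
  assumes nonneg: "\<And>x. 0 \<le> v x" and super: "\<And>x. x \<in> U \<Longrightarrow> laplacian G v x \<le> 0"
  obtains h where "\<And>x. 0 \<le> h x" and "\<And>x. h x \<le> v x" and "\<And>x. x \<notin> U \<Longrightarrow> h x = v x"
    and "\<And>x. x \<in> U \<Longrightarrow> laplacian G h x = 0"
    and "\<And>s x. (\<And>y. s y \<le> v y) \<Longrightarrow> (\<And>y. y \<in> U \<Longrightarrow> 0 \<le> laplacian G s y) \<Longrightarrow> s x \<le> h x"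
proof -
  define F where "F n = (relax U ^^ n) v" for n
  have F_Suc: "F (Suc n) = relax U (F n)" for n
    by (simp add: F_def)
  have dec: "F (Suc n) x \<le> F n x" for n x
  proof (induction n arbitrary: x)
    case 0
    show ?case
      using super[of x] by (simp add: F_def relax_def divide_le_0_iff)
  next
    case (Suc n)
    show ?case
      using relax_mono[of "F (Suc n)" "F n" U x, OF Suc] by (simp only: F_Suc)
  qed
  have sub: "s x \<le> F n x"
    if s: "\<And>y. s y \<le> v y" "\<And>y. y \<in> U \<Longrightarrow> 0 \<le> laplacian G s y" for s n x
  proof (induction n arbitrary: x)
    case 0
    show ?case
      using s by (simp add: F_def)
  next
    case (Suc n)
    have "s x \<le> relax U s x"
      using s(2)[of x] by (simp add: relax_def)
    also have "\<dots> \<le> F (Suc n) x"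
      unfolding F_Suc by (rule relax_mono) (rule Suc)
    finally show ?case .
  qed
  have pos: "0 \<le> F n x" for n x
    by (rule sub) (use nonneg in \<open>auto simp: laplacian_const\<close>)
  have decseq: "decseq (\<lambda>n. F n x)" for x
    using dec by (simp add: decseq_Suc_iff)
  define h where "h x = lim (\<lambda>n. F n x)" for x
  have h: "(\<lambda>n. F n x) \<longlonglongrightarrow> h x" for x
  proof -
    obtain l where "(\<lambda>n. F n x) \<longlonglongrightarrow> l"
      by (rule decseq_convergent[OF decseq[of x], of 0]) (use pos in auto)
    then show ?thesis
      by (simp add: h_def limI)
  qed
  have lower: "c \<le> h x" if "\<And>n. c \<le> F n x" for c x
    by (rule LIMSEQ_le_const[OF h]) (use that in auto)
  show thesis
  proof (rule that)
    show "0 \<le> h x" for x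
      using pos by (intro lower) auto
    show "h x \<le> v x" for x
      using decseq_ge[OF decseq h, of x 0] by (simp add: F_def)
    show "h x = v x" if "x \<notin> U" for x
    proof -
      have "F n x = v x" for n
        by (induction n) (use that in \<open>auto simp: F_def relax_def\<close>)
      then show ?thesis
        using h[of x] by (simp add: LIMSEQ_const_iff)
    qed
    show "laplacian G h x = 0" if "x \<in> U" for x
    proof -
      have "(\<lambda>n. F n x + laplacian G (F n) x / A\<^sup>2) \<longlonglongrightarrow> h x + laplacian G h x / A\<^sup>2"
        unfolding laplacian_def by (intro tendsto_intros h) (use A_ge_1 in auto)
      moreover have "F n x + laplacian G (F n) x / A\<^sup>2 = F (Suc n) x" for n
        unfolding F_Suc using that by (simp add: relax_def)
      ultimately have "(\<lambda>n. F (Suc n) x) \<longlonglongrightarrow> h x + laplacian G h x / A\<^sup>2"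
        by simp
      then have "h x + laplacian G h x / A\<^sup>2 = h x"
        using LIMSEQ_unique LIMSEQ_Suc[OF h[of x]] by blast
      then show ?thesis
        using A_ge_1 by auto
    qed
    show "s x \<le> h x" if "\<And>y. s y \<le> v y" "\<And>y. y \<in> U \<Longrightarrow> 0 \<le> laplacian G s y" for s x
      using sub[OF that] by (intro lower) auto
  qed
qed


section \<open>A Liouville property under the Bakry-Emery condition\<close>

lemma Gam_eq:
  "Gam G u u x = (\<Sum>y | adj G x y. eweight G x y / vweight G x * (u y - u x)\<^sup>2) / 2"
proof -
  have "laplacian G (\<lambda>z. u z * u z) x - u x * laplacian G u x - u x * laplacian G u x
      = (\<Sum>y | adj G x y. eweight G x y / vweight G x * (u y - u x)\<^sup>2)"
    unfolding laplacian_def sum_distrib_left sum_subtractf[symmetric]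
    by (rule sum.cong)
      (auto simp: power2_eq_square algebra_simps add_divide_distrib diff_divide_distrib)
  then show ?thesis
    by (simp add: Gam_def)
qed

lemma Gam_nonneg: "0 \<le> Gam G u u x"
  using rate_sum_mono[of "{y. adj G x y}" x "\<lambda>_. 0" "\<lambda>y. (u y - u x)\<^sup>2"] by (simp add: Gam_eq)

lemma Gam_eq_0_iff: "Gam G u u x = 0 \<longleftrightarrow> (\<forall>y. adj G x y \<longrightarrow> u y = u x)"
proof -
  define t where "t y = eweight G x y / vweight G x * (u y - u x)\<^sup>2" for y
  have nonneg: "0 \<le> t y" and zero: "t y = 0 \<longleftrightarrow> u y = u x" if "adj G x y" for y
    unfolding t_def using rate_pos[OF that] by (auto intro!: mult_nonneg_nonneg simp del: times_divide_eq_left)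
  have "Gam G u u x = 0 \<longleftrightarrow> (\<Sum>y | adj G x y. t y) = 0"
    by (simp add: Gam_eq t_def)
  also have "\<dots> \<longleftrightarrow> (\<forall>y\<in>{y. adj G x y}. t y = 0)"
    by (rule sum_nonneg_eq_0_iff) (use nonneg in auto)
  finally show ?thesis
    using zero by auto
qed

lemma Gam2_nonneg:
  assumes "0 \<le> bakry_emery_curvature G x"
  shows "0 \<le> Gam2 G f x"
proof (rule field_le_epsilon)
  fix e :: real assume e: "0 < e"
  define d where "d = e / (Gam G f f x + 1)"
  have pos: "0 < Gam G f f x + 1"
    using Gam_nonneg[of f x] by simp
  then have d: "0 < d"
    using e by (simp add: d_def)
  then have "ereal (- d) < bakry_emery_curvature G x"
    using assms by (metis ereal_less(2) less_le_trans neg_less_0_iff_less zero_ereal_def less_ereal.simps(1))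
  then obtain K where K: "\<And>f. K * Gam G f f x \<le> Gam2 G f x" "- d < K"
    unfolding bakry_emery_curvature_def less_Sup_iff by auto
  have "- e \<le> - d * Gam G f f x"
    using pos e Gam_nonneg[of f x] by (simp add: d_def field_simps)
  also have "\<dots> \<le> K * Gam G f f x"
    using K(2) Gam_nonneg by (intro mult_right_mono) auto
  also have "\<dots> \<le> Gam2 G f x"
    by (rule K)
  finally show "0 \<le> Gam2 G f x + e"
    by simp
qed

text \<open>
  For harmonic \<open>u\<close>, the function \<open>u\<^sup>2\<close> has Laplacian \<open>2 \<Gamma>(u)\<close>. If \<open>\<Gamma>(u)\<close> is subharmonic, each step of
  the lazy random walk increases the mean of \<open>u\<^sup>2\<close> by at least a fixed multiple of \<open>\<Gamma>(u)\<close>; since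
  \<open>u\<^sup>2\<close> is bounded, \<open>\<Gamma>(u)\<close> has to vanish.
\<close>

lemma Gam_eq_0_of_subharmonic:
  assumes bounded: "\<And>x. \<bar>u x\<bar> \<le> M" and harm: "\<And>x. laplacian G u x = 0"
    and sub: "\<And>x. 0 \<le> laplacian G (Gam G u u) x"
  shows "Gam G u u x = 0"
proof -
  define W where "W n = (relax UNIV ^^ n) (\<lambda>x. u x * u x)" for n
  let ?g = "Gam G u u"
  let ?c = "2 / A\<^sup>2"
  have c: "0 < ?c"
    using A_ge_1 by simp
  have lap_sq: "laplacian G (\<lambda>x. u x * u x) x = 2 * ?g x" for x
    by (simp add: Gam_def harm)
  have W_le: "W n x \<le> M\<^sup>2" for n x
  proof (induction n arbitrary: x)
    case 0
    show ?case
      using power_mono[OF bounded[of x], of 2] by (simp add: W_def power2_eq_square)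
  next
    case (Suc n)
    have "W (Suc n) x \<le> relax UNIV (\<lambda>x. M\<^sup>2) x"
      unfolding W_def funpow.simps o_apply by (rule relax_mono) (use Suc in \<open>simp add: W_def\<close>)
    then show ?case
      by (simp add: relax_def laplacian_const)
  qed
  have W_ge: "u x * u x + real n * ?c * ?g x \<le> W n x" for n x
  proof (induction n arbitrary: x)
    case 0
    show ?case
      by (simp add: W_def)
  next
    case (Suc n)
    let ?s = "\<lambda>x. u x * u x + real n * ?c * ?g x"
    have "laplacian G ?s x = 2 * ?g x + real n * ?c * laplacian G ?g x"
      by (simp only: laplacian_add laplacian_cmult lap_sq)
    moreover have "0 \<le> real n * ?c * laplacian G ?g x"
      using sub c by (intro mult_nonneg_nonneg) auto
    ultimately have "2 * ?g x \<le> laplacian G ?s x"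
      by simp
    then have "2 * ?g x / A\<^sup>2 \<le> laplacian G ?s x / A\<^sup>2"
      by (rule divide_right_mono) simp
    then have "u x * u x + real (Suc n) * ?c * ?g x \<le> relax UNIV ?s x"
      by (simp only: relax_def UNIV_I if_True) (simp add: algebra_simps add_divide_distrib)
    also have "\<dots> \<le> relax UNIV (W n) x"
      by (rule relax_mono) (use Suc in simp)
    finally show ?case
      by (simp add: W_def)
  qed
  have "?g x \<le> 0"
  proof (rule ccontr)
    assume "\<not> ?g x \<le> 0"
    then have "0 < ?c * ?g x"
      using c by (intro mult_pos_pos) auto
    then obtain n where "M\<^sup>2 < real n * (?c * ?g x)"
      using reals_Archimedean3 by blast
    then show False
      using W_ge[of x n] W_le[of n x] by (simp add: mult.assoc) (smt (verit) zero_le_square)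
  qed
  then show ?thesis
    using Gam_nonneg[of u x] by simp
qed


section \<open>A Liouville property under the Ollivier condition\<close>

lemma laplacian_le_add:
  assumes "\<And>y. adj G x y \<Longrightarrow> f y - f x \<le> g y - g x + e" and "0 \<le> e"
  shows "laplacian G f x \<le> laplacian G g x + A\<^sup>2 * e"
proof -
  let ?p = "\<lambda>y. eweight G x y / vweight G x"
  have "laplacian G f x \<le> (\<Sum>y | adj G x y. ?p y * (g y - g x) + ?p y * e)"
    unfolding laplacian_def distrib_left[symmetric]
    by (rule rate_sum_mono) (use assms in auto)
  also have "\<dots> = laplacian G g x + (\<Sum>y | adj G x y. ?p y) * e"
    by (simp add: laplacian_def sum.distrib sum_distrib_right)
  also have "\<dots> \<le> laplacian G g x + A\<^sup>2 * e"
    using total_rate_le[of "{y. adj G x y}" x] assms(2) by (intro add_left_mono mult_right_mono) auto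
  finally show ?thesis .
qed

lemma ollivier_nonneg_laplacian:
  assumes xy: "adj G x y" and curv: "0 \<le> ollivier_curvature G x y"
    and lip: "\<And>a b. adj G a b \<Longrightarrow> f b - f a \<le> 1" and "f y - f x = 1"
  shows "laplacian G f y \<le> laplacian G f x"
proof -
  have dist: "gdist G a b = 1" if "adj G a b" for a b
    using that gdist_eq_1_iff by blast
  have "grad G y x f = 1"
    using assms(4) dist[OF adj_sym[OF xy]] by (simp add: grad_def)
  moreover have "grad_sup G f = 1"
    unfolding grad_sup_def
  proof (rule antisym)
    show "(SUP (a, b)\<in>{(a, b). adj G a b}. ereal (grad G a b f)) \<le> 1"
      using lip[OF adj_sym] dist by (auto intro!: SUP_least simp: grad_def)
    have "ereal (grad G y x f) \<le> (SUP (a, b)\<in>{(a, b). adj G a b}. ereal (grad G a b f))"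
      by (rule SUP_upper2[of "(y, x)"]) (use adj_sym[OF xy] in auto)
    then show "1 \<le> (SUP (a, b)\<in>{(a, b). adj G a b}. ereal (grad G a b f))"
      using \<open>grad G y x f = 1\<close> by (simp add: one_ereal_def)
  qed
  ultimately have "ollivier_curvature G x y \<le> ereal (grad G x y (laplacian G f))"
    unfolding ollivier_curvature_def by (intro INF_lower) auto
  then have "0 \<le> grad G x y (laplacian G f)"
    using curv by (metis ereal_less_eq(5) order_trans)
  then show ?thesis
    using dist[OF xy] by (simp add: grad_def)
qed

text \<open>
  If the gradient falls short of \<open>1\<close> by \<open>e\<close> on the edge, the function can be lowered by at most \<open>e\<close>
  to make it exactly \<open>1\<close>, without leaving the class of \<open>1\<close>-Lipschitz functions.
\<close>

lemma ollivier_nonneg_laplacian_almost: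
  assumes xy: "adj G x y" and curv: "0 \<le> ollivier_curvature G x y"
    and lip: "\<And>a b. adj G a b \<Longrightarrow> f b - f a \<le> 1" and e: "1 - e \<le> f y - f x"
  shows "laplacian G f y \<le> laplacian G f x + 2 * A\<^sup>2 * e"
proof -
  define g where "g v = min (f v) (f y - 1 + real (gdist G x v))" for v
  have e0: "0 \<le> e"
    using lip[OF xy] e by simp
  have g_le: "g v \<le> f v" for v
    by (simp add: g_def)
  have g_ge: "f v - e \<le> g v" for v
    using lipschitz_gdist[of f v x, OF lip] e e0 by (simp add: g_def)
  have gx: "g x = f y - 1"
    using lip[OF xy] gdist_eq_0_iff[of x x] by (simp add: g_def)
  have gy: "g y = f y"
    using gdist_eq_1_iff[of x y] xy by (simp add: g_def)
  have g_lip: "g b - g a \<le> 1" if "adj G a b" for a b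
    using lip[OF that] gdist_adj_le[OF that, of x] by (auto simp: g_def min_def)
  have "laplacian G g y \<le> laplacian G g x"
    by (rule ollivier_nonneg_laplacian[OF xy curv g_lip]) (use gx gy in auto)
  moreover have "laplacian G f y \<le> laplacian G g y + A\<^sup>2 * e"
  proof (rule laplacian_le_add)
    show "f v - f y \<le> g v - g y + e" for v
      using g_ge[of v] gy by simp
  qed (rule e0)
  moreover have "laplacian G g x \<le> laplacian G f x + A\<^sup>2 * e"
  proof (rule laplacian_le_add)
    show "g v - g x \<le> f v - f x + e" for v
      using g_le[of v] gx e by simp
  qed (rule e0)
  ultimately show ?thesis
    by simp
qed

text \<open>
  From an edge on which a harmonic \<open>1\<close>-Lipschitz function almost attains its Lipschitz constant, one
  gets to a higher such edge: harmonicity provides a neighbour \<open>z\<close> of \<open>y\<close> with a definite gain.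
  If no edge ending in \<open>z\<close> had almost maximal gradient, raising the function at \<open>z\<close> alone would keep
  it \<open>1\<close>-Lipschitz and increase its Laplacian at \<open>y\<close> but not at \<open>x\<close>, contrary to the curvature
  condition.
\<close>

lemma ollivier_ascent:
  assumes xy: "adj G x y" and curv: "0 \<le> ollivier_curvature G x y"
    and lip: "\<And>a b. adj G a b \<Longrightarrow> f b - f a \<le> 1" and harm: "\<And>x. laplacian G f x = 0"
    and e: "1 - e \<le> f y - f x" and e0: "0 < e" and small: "4 * A ^ 3 * e \<le> 1"
  shows "\<exists>x' z. adj G x' z \<and> 1 - 3 * A ^ 3 * e \<le> f z - f x' \<and> f y + 1 / (2 * A ^ 3) \<le> f z"
proof -
  \<comment> \<open>The descent to \<open>x\<close> is at least \<open>3/4\<close>, has weight at least \<open>1/A\<close>, and has to be balanced by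
    neighbours of total weight at most \<open>A\<^sup>2\<close>; so the gain \<open>t\<close> is reached by one of them.\<close>
  define t where "t = 1 / (2 * A ^ 3)"
  let ?p = "\<lambda>z. eweight G y z / vweight G y"
  have A: "0 < A"
    using A_ge_1 by simp
  have A3: "1 \<le> A ^ 3"
    using A_ge_1 by (simp add: one_le_power)
  have "4 * e \<le> 4 * A ^ 3 * e"
    using A3 e0 by (intro mult_right_mono) auto
  then have e_small: "e \<le> 1 / 4"
    using small by simp
  have e_t: "e < t"
    using small A e0 by (simp add: t_def field_simps)
  have t0: "0 < t"
    using A by (simp add: t_def)
  obtain z where z: "adj G y z" "f y + t \<le> f z"
  proof -
    have "\<exists>z. adj G y z \<and> f y + t \<le> f z"
    proof (rule ccontr)
      assume "\<nexists>z. adj G y z \<and> f y + t \<le> f z"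
      then have less: "f z - f y \<le> t" if "adj G y z" for z
        using that by (smt (verit))
      have yx: "adj G y x"
        by (rule adj_sym[OF xy])
      have "laplacian G f y = ?p x * (f x - f y) + (\<Sum>z\<in>{z. adj G y z} - {x}. ?p z * (f z - f y))"
        unfolding laplacian_def by (rule sum.remove) (use yx in auto)
      also have "(\<Sum>z\<in>{z. adj G y z} - {x}. ?p z * (f z - f y)) \<le> (\<Sum>z\<in>{z. adj G y z} - {x}. ?p z * t)"
        by (rule rate_sum_mono) (use less in auto)
      also have "\<dots> = (\<Sum>z\<in>{z. adj G y z} - {x}. ?p z) * t"
        by (simp only: sum_distrib_right)
      also have "\<dots> \<le> A\<^sup>2 * t"
        by (intro mult_right_mono total_rate_le) (use t0 in auto)
      also have "A\<^sup>2 * t = 1 / A * (1 / 2)"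
        using A by (simp add: t_def power2_eq_square power3_eq_cube)
      finally have "?p x * (f y - f x) \<le> 1 / A * (1 / 2)"
        using harm[of y] by (simp add: algebra_simps diff_divide_distrib)
      moreover have "1 / A * (3 / 4) \<le> ?p x * (f y - f x)"
      proof (rule mult_mono)
        show "3 / 4 \<le> f y - f x"
          using e e_small by simp
        show "0 \<le> ?p x"
          using rate_pos[OF yx] by simp
      qed (use rate_ge[OF yx] in simp_all)
      ultimately have "1 / A * (3 / 4) \<le> 1 / A * (1 / 2)"
        by (rule order_trans[rotated])
      then show False
        using A by (simp add: field_simps)
    qed
    then show thesis
      using that by blast
  qed
  have "1 < f z - f x"
    using z(2) e e_t by linarith
  then have z_x: "\<not> adj G x z" "z \<noteq> x" "z \<noteq> y"
    using lip[of x z] z(1) adj_irrefl by force+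
  \<comment> \<open>Raising the function by \<open>d\<close> at \<open>z\<close> contributes at least \<open>d/A = 3 A\<^sup>2 e\<close> to the Laplacian at \<open>y\<close>,
    more than the error \<open>2 A\<^sup>2 e\<close> caused by the deficit of the gradient on the edge.\<close>
  define d where "d = 3 * A ^ 3 * e"
  have "\<exists>x'. adj G x' z \<and> 1 - d \<le> f z - f x'"
  proof (rule ccontr)
    assume contra: "\<nexists>x'. adj G x' z \<and> 1 - d \<le> f z - f x'"
    have d0: "0 \<le> d"
      using A e0 by (simp add: d_def)
    define b :: "'v \<Rightarrow> real" where "b v = (if v = z then d else 0)" for v
    have "laplacian G (\<lambda>v. f v + b v) y \<le> laplacian G (\<lambda>v. f v + b v) x + 2 * A\<^sup>2 * e"
    proof (rule ollivier_nonneg_laplacian_almost[OF xy curv])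
      show "f v + b v - (f a + b a) \<le> 1" if "adj G a v" for a v
        using that contra lip[OF that] d0 by (auto simp: b_def)
      show "1 - e \<le> f y + b y - (f x + b x)"
        using z_x e by (auto simp: b_def)
    qed
    moreover have "laplacian G b x = 0"
      unfolding laplacian_def by (rule sum.neutral) (use z_x in \<open>auto simp: b_def\<close>)
    moreover have "laplacian G b y = ?p z * d"
    proof -
      have "laplacian G b y = (\<Sum>v | adj G y v. if v = z then ?p z * d else 0)"
        unfolding laplacian_def by (rule sum.cong) (use z_x in \<open>auto simp: b_def\<close>)
      then show ?thesis
        using z(1) by simp
    qed
    ultimately have "?p z * d \<le> 2 * A\<^sup>2 * e"
      by (simp add: laplacian_add harm)
    moreover have "1 / A * d \<le> ?p z * d"
      by (rule mult_right_mono) (use rate_ge[OF z(1)] d0 in auto)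
    moreover have "1 / A * d = 3 * (A\<^sup>2 * e)"
      using A by (simp add: d_def power2_eq_square power3_eq_cube)
    moreover have "0 < A\<^sup>2 * e"
      using A e0 by simp
    ultimately show False
      by simp
  qed
  then show ?thesis
    using z unfolding d_def t_def by blast
qed

text \<open>
  The hypothesis on the curvature is restricted to edges along which \<open>u\<close> varies, since these are the
  only ones met on the way up.
\<close>

lemma ollivier_liouville:
  assumes bounded: "\<And>x. \<bar>u x\<bar> \<le> M" and harm: "\<And>x. laplacian G u x = 0"
    and curv: "\<And>x y. adj G x y \<Longrightarrow> u x \<noteq> u y \<Longrightarrow> 0 \<le> ollivier_curvature G x y"
    and ab: "adj G a b"
  shows "u a = u b"
proof (rule ccontr)
  assume ne: "u a \<noteq> u b"
  define S where "S = {u y - u x | x y. adj G x y}"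
  have bdd: "bdd_above S"
  proof (rule bdd_aboveI)
    fix s assume "s \<in> S"
    then obtain x y where "s = u y - u x"
      by (auto simp: S_def)
    then show "s \<le> 2 * M"
      using bounded[of x] bounded[of y] by simp
  qed
  define L where "L = Sup S"
  have L_ge: "u y - u x \<le> L" if "adj G x y" for x y
    unfolding L_def by (rule cSup_upper) (use that bdd in \<open>auto simp: S_def\<close>)
  have L0: "0 < L"
    using L_ge[OF ab] L_ge[OF adj_sym[OF ab]] ne by linarith
  define f where "f x = u x / L" for x
  define m where "m = - M / L"
  have f_ge: "m \<le> f x" and f_le: "f x \<le> - m" for x
    using bounded[of x] L0 by (auto simp: f_def m_def field_simps)
  have lip: "f y - f x \<le> 1" if "adj G x y" for x y
    using L_ge[OF that] L0 by (simp add: f_def field_simps)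
  have harm_f: "laplacian G f x = 0" for x
    using laplacian_cmult[of "1 / L" u x] harm[of x] by (simp add: f_def[abs_def])
  have A: "0 < A"
    using A_ge_1 by simp
  let ?t = "1 / (2 * A ^ 3)"
  \<comment> \<open>The tolerance \<open>e\<close> is arbitrary for each number \<open>k\<close> of steps, which absorbs the loss in each step.\<close>
  have climb: "\<exists>x y. adj G x y \<and> 1 - e \<le> f y - f x \<and> m + real k * ?t \<le> f y" if "0 < e" for k e
    using that
  proof (induction k arbitrary: e)
    case 0
    have "L * (1 - e) < Sup S"
      using 0 L0 by (simp add: L_def[symmetric] algebra_simps)
    moreover have "S \<noteq> {}"
      using ab by (auto simp: S_def)
    ultimately obtain s where "s \<in> S" "L * (1 - e) < s"
      using less_cSup_iff[OF _ bdd] by blast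
    then obtain x y where xy: "adj G x y" "L * (1 - e) < u y - u x"
      by (auto simp: S_def)
    then have "1 - e \<le> f y - f x"
      using L0 by (simp add: f_def field_simps)
    then show ?case
      using xy f_ge by auto
  next
    case (Suc k)
    define e' where "e' = min (e / (3 * A ^ 3)) (1 / (4 * A ^ 3))"
    have e': "0 < e'" "3 * A ^ 3 * e' \<le> e" "4 * A ^ 3 * e' \<le> 1"
      using Suc.prems A by (auto simp: e'_def min_def field_simps)
    obtain x y where xy: "adj G x y" "1 - e' \<le> f y - f x" "m + real k * ?t \<le> f y"
      using Suc.IH[OF e'(1)] by blast
    have "4 * e' \<le> 4 * A ^ 3 * e'"
      using A_ge_1 e'(1) by (intro mult_right_mono) (auto simp: one_le_power)
    then have "f x \<noteq> f y"
      using e'(3) xy(2) by linarith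
    then have "u x \<noteq> u y"
      by (auto simp: f_def)
    then obtain x' z where z: "adj G x' z" "1 - 3 * A ^ 3 * e' \<le> f z - f x'" "f y + ?t \<le> f z"
      using ollivier_ascent[OF xy(1) curv[OF xy(1)] lip harm_f xy(2) e'(1,3)] by blast
    have "m + real (Suc k) * ?t \<le> f z"
      using z(3) xy(3) by (simp add: add_divide_distrib)
    then show ?case
      using z(1,2) e'(2) by (intro exI[of _ x'] exI[of _ z]) auto
  qed
  have "0 < ?t"
    using A by simp
  then obtain k where "- 2 * m < real k * ?t"
    using reals_Archimedean3 by blast
  moreover obtain y where "m + real k * ?t \<le> f y"
    using climb[of 1 k] by auto
  ultimately show False
    using f_le[of y] by simp
qed


section \<open>Harmonic functions determined by their values on a sphere\<close>

lemma harmonic_eq_0: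
  assumes curv: "CD_0_inf_outside G (graph_ball G x0 R) \<or>
      nonneg_ollivier_outside G (graph_ball G x0 R)"
    and bounded: "\<And>x. \<bar>u x\<bar> \<le> M" and harm: "\<And>x. laplacian G u x = 0"
    and zero: "\<And>x. x \<in> graph_sphere G x0 (R + 1) \<Longrightarrow> u x = 0"
    and inf: "infinite (UNIV :: 'v set)"
  shows "u x = 0"
proof -
  have ball: "u x = 0" if "x \<in> graph_ball G x0 (R + 1)" for x
    using harmonic_vanishing_on_sphere[OF harm zero inf that] .
  have near: "y \<in> graph_ball G x0 (R + 1)" if "x \<in> graph_ball G x0 R" "adj G x y" for x y
    using that gdist_adj_le[OF that(2), of x0] by (auto simp: graph_ball_def)
  have near': "x \<in> graph_ball G x0 (R + 1)" if "x \<in> graph_ball G x0 R" for x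
    using that by (auto simp: graph_ball_def)
  have const: "u y = u x" if "adj G x y" for x y
    using curv
  proof
    assume CD: "CD_0_inf_outside G (graph_ball G x0 R)"
    have "0 \<le> laplacian G (Gam G u u) x" for x
    proof (cases "x \<in> graph_ball G x0 R")
      case True
      \<comment> \<open>Here \<open>u\<close> vanishes at \<open>x\<close> and its neighbours, so \<open>\<Gamma>(u)\<close> attains its minimum \<open>0\<close> at \<open>x\<close>.\<close>
      then have "Gam G u u x = 0"
        using ball near near' by (simp add: Gam_eq_0_iff)
      then have "laplacian G (\<lambda>x. 0) x \<le> laplacian G (Gam G u u) x"
        by (intro laplacian_mono_at) (simp add: Gam_nonneg)
      then show ?thesis
        by (simp add: laplacian_const)
    next
      case False
      then have "0 \<le> Gam2 G u x"
        using CD by (intro Gam2_nonneg) (simp add: CD_0_inf_outside_def)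
      moreover have "Gam G u (laplacian G u) x = 0"
        using harm by (simp add: Gam_def laplacian_def)
      ultimately show ?thesis
        by (simp add: Gam2_def)
    qed
    then have "Gam G u u x = 0"
      using Gam_eq_0_of_subharmonic[OF bounded harm] by blast
    then show ?thesis
      using that by (simp add: Gam_eq_0_iff)
  next
    assume Oll: "nonneg_ollivier_outside G (graph_ball G x0 R)"
    have "0 \<le> ollivier_curvature G a b" if ab: "adj G a b" "u a \<noteq> u b" for a b
    proof -
      have "a \<notin> graph_ball G x0 R" "b \<notin> graph_ball G x0 R"
        using near[OF _ ab(1)] near[OF _ adj_sym[OF ab(1)]] near' ball ab(2) by metis+
      then show ?thesis
        using Oll ab(1) by (auto simp: nonneg_ollivier_outside_def)
    qed
    then show ?thesis
      using ollivier_liouville[OF bounded harm _ that] by metis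
  qed
  have "u x = u x0"
    by (rule closed_under_adj_UNIV[of _ x0]) (use const in auto)
  moreover have "x0 \<in> graph_ball G x0 (R + 1)"
    using gdist_eq_0_iff[of x0 x0] by (simp add: graph_ball_def)
  ultimately show ?thesis
    using ball by simp
qed

end


section \<open>Barriers and non-parabolic ends\<close>

text \<open>
  A bounded superharmonic function that is \<open>1\<close> outside \<open>\<Pi>\<close> and has infimum \<open>0\<close>. The existence of a
  barrier characterises non-parabolic ends other than the whole graph, and unlike the function in the
  definition of non-parabolicity a barrier need not be harmonic on \<open>\<Pi>\<close>.
\<close>

definition barrier :: "'v wgraph \<Rightarrow> 'v set \<Rightarrow> ('v \<Rightarrow> real) \<Rightarrow> bool" where
  "barrier G \<Pi> v \<longleftrightarrow> (\<forall>x. 0 \<le> v x \<and> v x \<le> 1) \<and> (\<forall>x. x \<notin> \<Pi> \<longrightarrow> v x = 1) \<and>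
     (\<forall>x. laplacian G v x \<le> 0) \<and> (\<forall>e>0. \<exists>x. v x < e)"

context connected_wgraph
begin

lemma nonparabolic_imp_barrier:
  assumes "\<Pi> \<noteq> {}" and "nonparabolic G \<Pi>"
  shows "\<exists>v. barrier G \<Pi> v"
proof -
  obtain f x0 where f: "\<And>x. x \<in> \<Pi> \<union> outer_boundary G \<Pi> \<Longrightarrow> 0 < f x"
    "\<And>x. x \<in> \<Pi> \<Longrightarrow> laplacian G f x = 0" "\<And>x. x \<in> outer_boundary G \<Pi> \<Longrightarrow> f x = 1"
    and lim: "Liminf (inf (vertex_infinity G x0) (principal \<Pi>)) (\<lambda>x. ereal (f x)) < 1"
    using assms(2) unfolding nonparabolic_def by blast
  have "\<exists>x\<in>\<Pi>. f x < 1"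
  proof (rule ccontr)
    assume "\<not> (\<exists>x\<in>\<Pi>. f x < 1)"
    then have "1 \<le> Liminf (inf (vertex_infinity G x0) (principal \<Pi>)) (\<lambda>x. ereal (f x))"
      by (intro Liminf_bounded) (auto simp: eventually_inf_principal not_less intro!: always_eventually)
    then show False
      using lim by simp
  qed
  then obtain a where a: "a \<in> \<Pi>" "f a < 1"
    by auto
  define v where "v x = (if x \<in> \<Pi> then min (f x) 1 else 1)" for x
  have v_super: "laplacian G v x \<le> 0" for x
    unfolding v_def[abs_def]
  proof (rule superharmonic_cap)
    show "1 \<le> f z" if "y \<in> \<Pi>" "adj G y z" "z \<notin> \<Pi>" for y z
    proof -
      have "z \<in> outer_boundary G \<Pi>"
        using that adj_sym outer_boundary_iff[OF assms(1)] by blast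
      then show ?thesis
        using f(3) by simp
    qed
  qed (use f in auto)
  have v01: "0 \<le> v x" "v x \<le> 1" for x
    using f(1)[of x] by (auto simp: v_def)
  \<comment> \<open>The infimum \<open>c\<close> of \<open>v\<close> is less than \<open>1\<close>; rescale to make it \<open>0\<close>.\<close>
  define c where "c = (INF x. v x)"
  have bdd: "bdd_below (range v)"
    using v01 by (intro bdd_belowI[of _ 0]) auto
  have c_le: "c \<le> v x" for x
    unfolding c_def by (rule cINF_lower[OF bdd]) simp
  have "v a < 1"
    using a by (simp add: v_def)
  then have c1: "c < 1"
    using c_le[of a] by simp
  define v' where "v' x = 1 / (1 - c) * v x + - c / (1 - c)" for x
  have v'_eq: "v' x = (v x - c) / (1 - c)" for x
    by (simp add: v'_def diff_divide_distrib)
  have "barrier G \<Pi> v'"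
    unfolding barrier_def
  proof (intro conjI allI impI)
    fix x
    show "0 \<le> v' x" "v' x \<le> 1"
      using c_le[of x] c1 v01[of x] by (auto simp: v'_eq)
    show "v' x = 1" if "x \<notin> \<Pi>"
      using that c1 by (simp add: v'_eq v_def)
    show "laplacian G v' x \<le> 0"
      unfolding v'_def[abs_def] laplacian_affine
      using v_super[of x] c1 by (simp add: mult_nonneg_nonpos divide_le_0_iff)
  next
    fix e :: real assume e: "0 < e"
    then have "(INF x. v x) < c + e * (1 - c)"
      using c1 by (simp add: c_def[symmetric])
    then obtain x where "v x < c + e * (1 - c)"
      using cINF_less_iff[OF _ bdd] by auto
    then have "v' x < e"
      using c1 by (simp add: v'_eq field_simps)
    then show "\<exists>x. v' x < e" ..
  qed
  then show ?thesis
    by blast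
qed

lemma barrier_pos:
  assumes "barrier G \<Pi> v" and "\<Pi> \<noteq> UNIV"
  shows "0 < v x"
proof -
  obtain a where "a \<notin> \<Pi>"
    using assms(2) by auto
  then have "v a = 1"
    using assms(1) unfolding barrier_def by blast
  then have "0 < v a"
    by simp
  then show ?thesis
    by (rule superharmonic_pos[rotated 2]) (use assms(1) in \<open>unfold barrier_def, blast+\<close>)
qed

lemma Liminf_less_1:
  fixes f :: "'v \<Rightarrow> real"
  assumes pos: "\<And>x. 0 < f x" and out: "\<And>x. x \<notin> \<Pi> \<Longrightarrow> f x = 1" and small: "\<And>e. 0 < e \<Longrightarrow> \<exists>x. f x < e"
  shows "Liminf (inf (vertex_infinity G x0) (principal \<Pi>)) (\<lambda>x. ereal (f x)) < 1"
proof (rule ccontr)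
  assume "\<not> ?thesis"
  then have "1 \<le> Liminf (inf (vertex_infinity G x0) (principal \<Pi>)) (\<lambda>x. ereal (f x))"
    by simp
  moreover have "ereal (1 / 2) < 1"
    by (simp add: one_ereal_def)
  ultimately have "ereal (1 / 2) < Liminf (inf (vertex_infinity G x0) (principal \<Pi>)) (\<lambda>x. ereal (f x))"
    by (rule less_le_trans[rotated])
  then have "eventually (\<lambda>x. ereal (1 / 2) < ereal (f x)) (inf (vertex_infinity G x0) (principal \<Pi>))"
    by (rule less_LiminfD)
  then have "eventually (\<lambda>x. x \<in> \<Pi> \<longrightarrow> 1 / 2 < f x) (vertex_infinity G x0)"
    by (simp add: eventually_inf_principal)
  then obtain N where N: "\<And>x. N \<le> gdist G x x0 \<Longrightarrow> x \<in> \<Pi> \<Longrightarrow> 1 / 2 < f x"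
    by (auto simp: vertex_infinity_def eventually_filtercomap eventually_at_top_linorder)
  let ?B = "graph_ball G x0 N"
  define e where "e = Min (insert (1 / 2) (f ` ?B))"
  have fin: "finite (insert (1 / 2) (f ` ?B))"
    using finite_graph_ball by simp
  have "0 < e"
    unfolding e_def using fin pos by (subst Min_gr_iff) auto
  then obtain x where x: "f x < e"
    using small by blast
  have e_le: "e \<le> 1 / 2" "x \<in> ?B \<Longrightarrow> e \<le> f x"
    unfolding e_def by (rule Min_le[OF fin]; simp)+
  have "x \<in> \<Pi>"
    using out[of x] x e_le by (cases "x \<in> \<Pi>") auto
  moreover have "x \<notin> ?B"
    using e_le x by auto
  ultimately have "1 / 2 < f x"
    using N[of x] by (simp add: graph_ball_def gdist_commute)
  then show False
    using e_le x by simp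
qed

end

context bounded_wgraph
begin

lemma barrier_imp_nonparabolic:
  assumes v: "barrier G \<Pi> v" and "\<Pi> \<noteq> {}" and "\<Pi> \<noteq> UNIV"
  shows "nonparabolic G \<Pi>"
proof -
  have v': "\<And>x. 0 \<le> v x" "\<And>x. v x \<le> 1" "\<And>x. x \<notin> \<Pi> \<Longrightarrow> v x = 1" "\<And>x. laplacian G v x \<le> 0"
    "\<And>e. 0 < e \<Longrightarrow> \<exists>x. v x < e"
    using v by (auto simp: barrier_def)
  obtain h where h: "\<And>x. 0 \<le> h x" "\<And>x. h x \<le> v x" "\<And>x. x \<notin> \<Pi> \<Longrightarrow> h x = v x"
    "\<And>x. x \<in> \<Pi> \<Longrightarrow> laplacian G h x = 0"
    using greatest_harmonic_minorant[of v \<Pi>] v'(1,4) by metis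
  have h1: "h x \<le> 1" for x
    using h(2) v'(2) order_trans by blast
  have out: "h x = 1" if "x \<notin> \<Pi>" for x
    using that h(3) v'(3) by simp
  have small: "\<exists>x. h x < e" if "0 < e" for e
    using v'(5)[OF that] h(2) by (meson le_less_trans)
  have super: "laplacian G h x \<le> 0" for x
  proof (cases "x \<in> \<Pi>")
    case False
    then have "laplacian G h x \<le> laplacian G (\<lambda>x. 1) x"
      by (intro laplacian_mono_at) (use out h1 in auto)
    then show ?thesis
      by (simp add: laplacian_const)
  qed (use h(4) in simp)
  have "barrier G \<Pi> h"
    using h(1) h1 out super small by (simp add: barrier_def)
  then have pos: "0 < h x" for x
    using barrier_pos assms(3) by blast
  show ?thesis
    unfolding nonparabolic_def
  proof (intro exI[of _ h] conjI ballI)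
    show "h x = 1" if "x \<in> outer_boundary G \<Pi>" for x
      using that out by (simp add: outer_boundary_def)
    show "\<exists>x0. Liminf (inf (vertex_infinity G x0) (principal \<Pi>)) (\<lambda>x. ereal (h x)) < 1"
      using Liminf_less_1[OF pos out small] by blast
  qed (use pos h(4) in auto)
qed

text \<open>
  A barrier of an end is positive, so it can only approach \<open>0\<close> along an infinite component that
  remains after more vertices have been removed. Dividing it by a positive lower bound on the removed
  set and capping at \<open>1\<close> yields a barrier of that component.
\<close>

lemma nonparabolic_end_refine:
  assumes "\<Omega> \<noteq> {}" and "\<Omega> \<subseteq> \<Omega>'" and "finite \<Omega>'"
    and \<Pi>: "\<Pi> \<in> graph_ends G \<Omega>" and "nonparabolic G \<Pi>"
  shows "\<exists>\<Pi>'\<in>graph_ends G \<Omega>'. nonparabolic G \<Pi>' \<and> \<Pi>' \<subseteq> \<Pi>"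
proof -
  have \<Pi>_comp: "\<Pi> \<in> induced_components G (- \<Omega>)" and \<Pi>_inf: "infinite \<Pi>"
    using \<Pi> by (auto simp: graph_ends_def)
  have \<Pi>_sub: "\<Pi> \<subseteq> - \<Omega>"
    by (rule component_subset[OF \<Pi>_comp])
  have \<Pi>_ne: "\<Pi> \<noteq> {}" "\<Pi> \<noteq> UNIV"
    using \<Pi>_inf \<Pi>_sub assms(1) by auto
  obtain v where v: "barrier G \<Pi> v"
    using nonparabolic_imp_barrier \<Pi>_ne(1) assms(5) by blast
  have pos: "0 < v x" for x
    using barrier_pos[OF v \<Pi>_ne(2)] .
  have v': "\<And>x. 0 \<le> v x" "\<And>x. v x \<le> 1" "\<And>x. x \<notin> \<Pi> \<Longrightarrow> v x = 1" "\<And>x. laplacian G v x \<le> 0"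
    "\<And>e. 0 < e \<Longrightarrow> \<exists>x. v x < e"
    using v by (auto simp: barrier_def)
  define away where "away S \<longleftrightarrow> (\<exists>e>0. \<forall>x\<in>S. e \<le> v x)" for S
  have away_finite: "away S" if "finite S" for S
  proof -
    have fin: "finite (insert 1 (v ` S))"
      using that by simp
    have "0 < Min (insert 1 (v ` S))"
      using fin pos by (subst Min_gr_iff) auto
    moreover have "\<forall>x\<in>S. Min (insert 1 (v ` S)) \<le> v x"
      using fin by (auto intro!: Min_le)
    ultimately show ?thesis
      unfolding away_def by blast
  qed
  have away_Un: "away (S \<union> T)" if ST: "away S" "away T" for S T
  proof -
    obtain a b where "0 < a" "\<forall>x\<in>S. a \<le> v x" "0 < b" "\<forall>x\<in>T. b \<le> v x"
      using ST by (auto simp: away_def)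
    then show ?thesis
      unfolding away_def by (intro exI[of _ "min a b"]) (auto simp: min_le_iff_disj)
  qed
  have away_Union: "away (\<Union>\<C>)" if "finite \<C>" "\<And>C. C \<in> \<C> \<Longrightarrow> away C" for \<C>
    using that by (induction rule: finite_induct) (auto intro: away_Un away_finite)
  let ?\<C> = "induced_components G (- \<Omega>')"
  have "\<exists>C\<in>?\<C>. infinite C \<and> C \<subseteq> \<Pi> \<and> \<not> away C"
  proof (rule ccontr)
    assume contra: "\<not> (\<exists>C\<in>?\<C>. infinite C \<and> C \<subseteq> \<Pi> \<and> \<not> away C)"
    have "away C" if C: "C \<in> ?\<C>" for C
    proof (cases "C \<inter> \<Pi> = {}")
      case True
      then have "\<forall>x\<in>C. 1 \<le> v x"
        using v'(3) by (metis disjoint_iff order_refl)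
      then show ?thesis
        unfolding away_def by (meson zero_less_one)
    next
      case False
      then obtain x where "x \<in> C" "x \<in> \<Pi>"
        by auto
      then have "C \<subseteq> \<Pi>"
        using component_mono[OF C \<Pi>_comp] assms(2) by blast
      then show ?thesis
        using contra C away_finite by blast
    qed
    moreover have "finite ?\<C>"
      using finite_components assms(1-3) by auto
    ultimately have "away (\<Union>?\<C>)"
      by (intro away_Union)
    then have "away (\<Union>?\<C> \<union> \<Omega>')"
      by (rule away_Un) (rule away_finite[OF assms(3)])
    moreover have "\<Union>?\<C> \<union> \<Omega>' = UNIV"
      using ex_component[of _ "- \<Omega>'"] by auto
    ultimately obtain e where "0 < e" "\<And>x. e \<le> v x"
      by (auto simp: away_def)
    then show False
      using v'(5)[of e] by (meson not_less)
  qed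
  then obtain C where C: "C \<in> ?\<C>" "infinite C" "C \<subseteq> \<Pi>" "\<not> away C"
    by auto
  obtain m where m: "0 < m" "\<And>x. x \<in> \<Omega>' \<Longrightarrow> m \<le> v x"
    using away_finite[OF assms(3)] by (auto simp: away_def)
  define g where "g x = (if x \<in> C then min (1 / m * v x) 1 else 1)" for x
  have "barrier G C g"
    unfolding barrier_def
  proof (intro conjI allI impI)
    fix x
    show "0 \<le> g x" "g x \<le> 1"
      using v'(1)[of x] m(1) by (auto simp: g_def)
    show "g x = 1" if "x \<notin> C"
      using that by (simp add: g_def)
    show "laplacian G g x \<le> 0"
      unfolding g_def[abs_def]
    proof (rule superharmonic_cap)
      show "laplacian G (\<lambda>x. 1 / m * v x) y \<le> 0" for y
        unfolding laplacian_cmult using v'(4)[of y] m(1) by (simp add: divide_le_0_iff)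
      show "1 \<le> 1 / m * v z" if "y \<in> C" "adj G y z" "z \<notin> C" for y z
      proof -
        have "z \<in> \<Omega>'"
          using component_adj[OF C(1) that(1,2)] that(3) by auto
        then show ?thesis
          using m by (simp add: field_simps)
      qed
    qed
  next
    fix e :: real assume "0 < e"
    then have "\<exists>x\<in>C. v x < e * m"
      using C(4) m(1) unfolding away_def by (meson mult_pos_pos not_less)
    then obtain x where "x \<in> C" "v x < e * m"
      by auto
    then have "g x < e"
      using m(1) by (simp add: g_def field_simps min_less_iff_disj)
    then show "\<exists>x. g x < e" ..
  qed
  moreover have "C \<noteq> {}" "C \<noteq> UNIV"
    using C(2,3) \<Pi>_ne by auto
  ultimately have "nonparabolic G C"
    by (rule barrier_imp_nonparabolic)
  then show ?thesis
    using C by (auto simp: graph_ends_def)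
qed


section \<open>Counting non-parabolic ends\<close>

lemma ecount_inj_le:
  assumes "inj_on f X" and "f ` X \<subseteq> Y"
  shows "ecount X \<le> ecount Y"
  using assms card_inj_on_le[of f X Y] inj_on_finite[of f X Y] by (auto simp: ecount_def)

lemma num_nonparabolic_ends_wrt_mono:
  assumes "\<Omega> \<noteq> {}" and "\<Omega> \<subseteq> \<Omega>'" and "finite \<Omega>'"
  shows "num_nonparabolic_ends_wrt G \<Omega> \<le> num_nonparabolic_ends_wrt G \<Omega>'"
proof -
  let ?E = "\<lambda>\<Omega>. {\<Pi> \<in> graph_ends G \<Omega>. nonparabolic G \<Pi>}"
  have "\<forall>\<Pi>\<in>?E \<Omega>. \<exists>\<Pi>'. \<Pi>' \<in> ?E \<Omega>' \<and> \<Pi>' \<subseteq> \<Pi>"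
    using nonparabolic_end_refine[OF assms] by auto
  then obtain F where F: "\<And>\<Pi>. \<Pi> \<in> ?E \<Omega> \<Longrightarrow> F \<Pi> \<in> ?E \<Omega>' \<and> F \<Pi> \<subseteq> \<Pi>"
    by metis
  have "inj_on F (?E \<Omega>)"
  proof (rule inj_onI)
    fix \<Pi> \<Pi>' assume P: "\<Pi> \<in> ?E \<Omega>" "\<Pi>' \<in> ?E \<Omega>" "F \<Pi> = F \<Pi>'"
    have "infinite (F \<Pi>)"
      using F[OF P(1)] by (simp add: graph_ends_def)
    then obtain x where "x \<in> F \<Pi>"
      by (metis ex_in_conv finite.emptyI)
    then have "x \<in> \<Pi>" "x \<in> \<Pi>'"
      using F[OF P(1)] F[OF P(2)] P(3) by auto
    then show "\<Pi> = \<Pi>'"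
      using components_disjoint P(1,2) by (auto simp: graph_ends_def)
  qed
  then show ?thesis
    unfolding num_nonparabolic_ends_wrt_def by (rule ecount_inj_le) (use F in auto)
qed

end

lemma ex_nontrivial_solution:
  fixes a :: "'e \<Rightarrow> 's \<Rightarrow> real"
  assumes "finite S" and "finite E" and "card S < card E"
  shows "\<exists>c. (\<exists>e\<in>E. c e \<noteq> 0) \<and> (\<forall>s\<in>S. (\<Sum>e\<in>E. c e * a e s) = 0)"
  using assms
proof (induction S arbitrary: E a rule: finite_induct)
  case empty
  then have "E \<noteq> {}"
    by auto
  then show ?case
    by (intro exI[of _ "\<lambda>_. 1"]) auto
next
  case (insert s S)
  show ?case
  proof (cases "\<forall>e\<in>E. a e s = 0")
    case True
    obtain c where "\<exists>e\<in>E. c e \<noteq> 0" "\<forall>s\<in>S. (\<Sum>e\<in>E. c e * a e s) = 0"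
      using insert.IH[of E a] insert.prems insert.hyps by auto
    then show ?thesis
      using True by (intro exI[of _ c]) auto
  next
    case False
    then obtain d where d: "d \<in> E" "a d s \<noteq> 0"
      by auto
    let ?E = "E - {d}"
    have "card S < card ?E"
      using insert.prems insert.hyps d by simp
    then obtain c where c: "\<exists>e\<in>?E. c e \<noteq> 0"
      "\<And>t. t \<in> S \<Longrightarrow> (\<Sum>e\<in>?E. c e * (a e t - a e s / a d s * a d t)) = 0"
      using insert.IH[of ?E "\<lambda>e t. a e t - a e s / a d s * a d t"] insert.prems by auto
    define c' where "c' = c(d := - (\<Sum>e\<in>?E. c e * a e s) / a d s)"
    have "(\<Sum>e\<in>E. c' e * a e t) = (\<Sum>e\<in>?E. c e * (a e t - a e s / a d s * a d t))" for t
    proof -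
      have "(\<Sum>e\<in>E. c' e * a e t) = c' d * a d t + (\<Sum>e\<in>?E. c' e * a e t)"
        using insert.prems d by (intro sum.remove) auto
      also have "(\<Sum>e\<in>?E. c' e * a e t) = (\<Sum>e\<in>?E. c e * a e t)"
        by (rule sum.cong) (auto simp: c'_def)
      finally show ?thesis
        by (simp add: c'_def right_diff_distrib sum_subtractf sum_distrib_right
            sum_divide_distrib mult.assoc)
    qed
    moreover have "\<exists>e\<in>E. c' e \<noteq> 0"
      using c(1) by (auto simp: c'_def)
    ultimately show ?thesis
      using c(2) d by (intro exI[of _ c']) (auto simp: field_simps)
  qed
qed

context bounded_wgraph
begin

text \<open>
  A family of barriers of disjoint sets produces linearly independent bounded harmonic functions
  \<open>h \<Pi>\<close>, the complements to \<open>1\<close> of the greatest harmonic minorants: at points where the barrier of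
  \<open>\<Pi>\<close> is small, \<open>h \<Pi>\<close> is close to \<open>1\<close> and the other functions of the family are close to \<open>0\<close>.
\<close>

lemma barriers_independent:
  assumes disj: "\<And>\<Pi> \<Pi>'. \<Pi> \<in> E \<Longrightarrow> \<Pi>' \<in> E \<Longrightarrow> \<Pi> \<noteq> \<Pi>' \<Longrightarrow> \<Pi> \<inter> \<Pi>' = {}"
    and bar: "\<And>\<Pi>. \<Pi> \<in> E \<Longrightarrow> \<exists>v. barrier G \<Pi> v"
    and fin: "finite E"
  obtains h where "\<And>\<Pi> x. \<Pi> \<in> E \<Longrightarrow> 0 \<le> h \<Pi> x \<and> h \<Pi> x \<le> 1"
    and "\<And>\<Pi> x. \<Pi> \<in> E \<Longrightarrow> laplacian G (h \<Pi>) x = 0"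
    and "\<And>c \<Pi>. (\<And>x. (\<Sum>\<Pi>\<in>E. c \<Pi> * h \<Pi> x) = 0) \<Longrightarrow> \<Pi> \<in> E \<Longrightarrow> c \<Pi> = 0"
proof -
  obtain v where v: "\<And>\<Pi>. \<Pi> \<in> E \<Longrightarrow> barrier G \<Pi> (v \<Pi>)"
    using bar by metis
  then have v': "\<And>x. 0 \<le> v \<Pi> x" "\<And>x. v \<Pi> x \<le> 1" "\<And>x. x \<notin> \<Pi> \<Longrightarrow> v \<Pi> x = 1"
    "\<And>x. laplacian G (v \<Pi>) x \<le> 0" "\<And>e. 0 < e \<Longrightarrow> \<exists>x. v \<Pi> x < e" if "\<Pi> \<in> E" for \<Pi>
    using that by (auto simp: barrier_def)
  have "\<exists>k. (\<forall>x. 0 \<le> k x) \<and> (\<forall>x. k x \<le> v \<Pi> x) \<and> (\<forall>x. laplacian G k x = 0) \<and>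
      (\<forall>s. (\<forall>y. s y \<le> v \<Pi> y) \<and> (\<forall>y. 0 \<le> laplacian G s y) \<longrightarrow> (\<forall>x. s x \<le> k x))"
    if P: "\<Pi> \<in> E" for \<Pi>
  proof -
    obtain k where k: "\<And>x. 0 \<le> k x" "\<And>x. k x \<le> v \<Pi> x" "\<And>x. laplacian G k x = 0"
      "\<And>s x. (\<And>y. s y \<le> v \<Pi> y) \<Longrightarrow> (\<And>y. 0 \<le> laplacian G s y) \<Longrightarrow> s x \<le> k x"
      using greatest_harmonic_minorant[of "v \<Pi>" UNIV] v'(1,4)[OF P] by (metis UNIV_I)
    then show ?thesis
      by blast
  qed
  then obtain k where k: "\<And>\<Pi> x. \<Pi> \<in> E \<Longrightarrow> 0 \<le> k \<Pi> x" "\<And>\<Pi> x. \<Pi> \<in> E \<Longrightarrow> k \<Pi> x \<le> v \<Pi> x"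
    "\<And>\<Pi> x. \<Pi> \<in> E \<Longrightarrow> laplacian G (k \<Pi>) x = 0"
    "\<And>\<Pi> s x. \<Pi> \<in> E \<Longrightarrow> (\<forall>y. s y \<le> v \<Pi> y) \<Longrightarrow> (\<forall>y. 0 \<le> laplacian G s y) \<Longrightarrow> s x \<le> k \<Pi> x"
    by metis
  define h where "h \<Pi> x = -1 * k \<Pi> x + 1" for \<Pi> x
  have h01: "0 \<le> h \<Pi> x \<and> h \<Pi> x \<le> 1" if "\<Pi> \<in> E" for \<Pi> x
    using k(1,2)[OF that, of x] v'(2)[OF that, of x] by (simp add: h_def)
  have other: "h \<Pi>' x \<le> v \<Pi> x" if P: "\<Pi> \<in> E" "\<Pi>' \<in> E" "\<Pi> \<noteq> \<Pi>'" for \<Pi> \<Pi>' x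
  proof -
    \<comment> \<open>Every vertex is outside \<open>\<Pi>\<close> or outside \<open>\<Pi>'\<close>, so \<open>1 - v \<Pi>\<close> is a subharmonic minorant of \<open>v \<Pi>'\<close>.\<close>
    have "-1 * v \<Pi> x + 1 \<le> k \<Pi>' x"
    proof (rule k(4)[OF P(2), of "\<lambda>x. -1 * v \<Pi> x + 1"]; rule allI)
      fix y
      show "-1 * v \<Pi> y + 1 \<le> v \<Pi>' y"
      proof (cases "y \<in> \<Pi>")
        case True
        then have "v \<Pi>' y = 1"
          using v'(3)[OF P(2), of y] disj[OF P] by auto
        then show ?thesis
          using v'(1)[OF P(1), of y] by simp
      qed (use v'(3)[OF P(1), of y] v'(1)[OF P(2), of y] in simp)
      show "0 \<le> laplacian G (\<lambda>x. -1 * v \<Pi> x + 1) y"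
        using v'(4)[OF P(1), of y] by (simp only: laplacian_affine)
    qed
    then show ?thesis
      by (simp add: h_def)
  qed
  have indep: "c \<Pi> = 0" if zero: "\<And>x. (\<Sum>\<Pi>\<in>E. c \<Pi> * h \<Pi> x) = 0" and P: "\<Pi> \<in> E" for c \<Pi>
  proof -
    let ?s = "\<Sum>\<Pi>\<in>E. \<bar>c \<Pi>\<bar>"
    have "\<bar>c \<Pi>\<bar> \<le> 0 + e" if e: "0 < e" for e
    proof -
      define d where "d = e / (?s + 1)"
      have s0: "0 \<le> ?s"
        by (simp add: sum_nonneg)
      have "0 < d"
        unfolding d_def using e s0 by (intro divide_pos_pos) linarith+
      then obtain x where x: "v \<Pi> x < d"
        using v'(5)[OF P] by blast
      have "0 = c \<Pi> * h \<Pi> x + (\<Sum>\<Pi>'\<in>E - {\<Pi>}. c \<Pi>' * h \<Pi>' x)"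
        using zero[of x] sum.remove[OF fin P, of "\<lambda>\<Pi>. c \<Pi> * h \<Pi> x"] by simp
      then have "c \<Pi> = c \<Pi> * k \<Pi> x - (\<Sum>\<Pi>'\<in>E - {\<Pi>}. c \<Pi>' * h \<Pi>' x)"
        by (simp add: h_def algebra_simps)
      then have "\<bar>c \<Pi>\<bar> \<le> \<bar>c \<Pi> * k \<Pi> x\<bar> + \<bar>\<Sum>\<Pi>'\<in>E - {\<Pi>}. c \<Pi>' * h \<Pi>' x\<bar>"
        by linarith
      also have "\<bar>c \<Pi> * k \<Pi> x\<bar> \<le> \<bar>c \<Pi>\<bar> * d"
        unfolding abs_mult using k(1,2)[OF P, of x] x by (intro mult_left_mono) auto
      also have "\<bar>\<Sum>\<Pi>'\<in>E - {\<Pi>}. c \<Pi>' * h \<Pi>' x\<bar> \<le> (\<Sum>\<Pi>'\<in>E - {\<Pi>}. \<bar>c \<Pi>'\<bar> * d)"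
      proof (rule order_trans[OF sum_abs sum_mono])
        fix \<Pi>' assume P': "\<Pi>' \<in> E - {\<Pi>}"
        then have "\<Pi>' \<in> E" "\<Pi> \<noteq> \<Pi>'"
          by auto
        then have "h \<Pi>' x \<le> d" "0 \<le> h \<Pi>' x"
          using other[OF P, of \<Pi>' x] x h01[of \<Pi>' x] by simp_all
        then show "\<bar>c \<Pi>' * h \<Pi>' x\<bar> \<le> \<bar>c \<Pi>'\<bar> * d"
          unfolding abs_mult by (intro mult_left_mono) auto
      qed
      also have "\<bar>c \<Pi>\<bar> * d + (\<Sum>\<Pi>'\<in>E - {\<Pi>}. \<bar>c \<Pi>'\<bar> * d) = ?s * d"
        using sum.remove[OF fin P, of "\<lambda>\<Pi>. \<bar>c \<Pi>\<bar> * d"] by (simp add: sum_distrib_right)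
      also have "\<dots> \<le> (?s + 1) * d"
        using \<open>0 < d\<close> by (intro mult_right_mono) auto
      also have "\<dots> = e"
      proof -
        have "?s + 1 \<noteq> 0"
          using s0 by linarith
        then show ?thesis
          by (simp add: d_def)
      qed
      finally show ?thesis
        by simp
    qed
    then have "\<bar>c \<Pi>\<bar> \<le> 0"
      by (rule field_le_epsilon)
    then show ?thesis
      by simp
  qed
  show thesis
  proof (rule that[of h])
    show "laplacian G (h \<Pi>) x = 0" if "\<Pi> \<in> E" for \<Pi> x
      unfolding h_def[abs_def] laplacian_affine using k(3)[OF that, of x] by simp
  qed (use h01 indep in blast)+
qed

lemma num_nonparabolic_ends_wrt_le:
  assumes curv: "CD_0_inf_outside G (graph_ball G x0 R) \<or>
      nonneg_ollivier_outside G (graph_ball G x0 R)"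
  shows "num_nonparabolic_ends_wrt G \<Omega> \<le> enat (card (graph_sphere G x0 (R + 1)))"
proof (rule ccontr)
  let ?S = "graph_sphere G x0 (R + 1)"
  let ?E = "{\<Pi> \<in> graph_ends G \<Omega>. nonparabolic G \<Pi>}"
  assume "\<not> ?thesis"
  then have large: "\<not> ecount ?E \<le> enat (card ?S)"
    by (simp add: num_nonparabolic_ends_wrt_def)
  obtain E where E: "E \<subseteq> ?E" "finite E" "card ?S < card E"
  proof (cases "finite ?E")
    case True
    then have "card ?S < card ?E"
      using large by (simp add: ecount_def)
    then show thesis
      using True that by blast
  next
    case False
    then obtain E where "finite E" "card E = Suc (card ?S)" "E \<subseteq> ?E"
      using infinite_arbitrarily_large by blast
    then show thesis
      using that by simp
  qed
  have end_inf: "infinite \<Pi>" if "\<Pi> \<in> E" for \<Pi>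
    using that E(1) by (auto simp: graph_ends_def)
  have "E \<noteq> {}"
    using E(3) by auto
  then have inf: "infinite (UNIV :: 'v set)"
    using end_inf finite_subset[OF subset_UNIV] by blast
  have disj: "\<Pi> \<inter> \<Pi>' = {}" if "\<Pi> \<in> E" "\<Pi>' \<in> E" "\<Pi> \<noteq> \<Pi>'" for \<Pi> \<Pi>'
    using that E(1) components_disjoint[of \<Pi> "- \<Omega>" \<Pi>'] by (auto simp: graph_ends_def)
  have bar: "\<exists>v. barrier G \<Pi> v" if "\<Pi> \<in> E" for \<Pi>
    using that E(1) end_inf[OF that] by (intro nonparabolic_imp_barrier) auto
  obtain h where h: "\<And>\<Pi> x. \<Pi> \<in> E \<Longrightarrow> 0 \<le> h \<Pi> x \<and> h \<Pi> x \<le> 1"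
    "\<And>\<Pi> x. \<Pi> \<in> E \<Longrightarrow> laplacian G (h \<Pi>) x = 0"
    "\<And>c \<Pi>. (\<And>x. (\<Sum>\<Pi>\<in>E. c \<Pi> * h \<Pi> x) = 0) \<Longrightarrow> \<Pi> \<in> E \<Longrightarrow> c \<Pi> = 0"
    using barriers_independent[OF disj bar E(2)] by blast
  obtain c where c: "\<exists>\<Pi>\<in>E. c \<Pi> \<noteq> 0" "\<And>x. x \<in> ?S \<Longrightarrow> (\<Sum>\<Pi>\<in>E. c \<Pi> * h \<Pi> x) = 0"
    using ex_nontrivial_solution[OF finite_graph_sphere E(2,3), of h] by blast
  have "(\<Sum>\<Pi>\<in>E. c \<Pi> * h \<Pi> x) = 0" for x
  proof (rule harmonic_eq_0[OF curv])
    show "\<bar>\<Sum>\<Pi>\<in>E. c \<Pi> * h \<Pi> x\<bar> \<le> (\<Sum>\<Pi>\<in>E. \<bar>c \<Pi>\<bar>)" for x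
    proof (rule order_trans[OF sum_abs sum_mono])
      fix \<Pi> assume "\<Pi> \<in> E"
      then show "\<bar>c \<Pi> * h \<Pi> x\<bar> \<le> \<bar>c \<Pi>\<bar>"
        using h(1)[of \<Pi> x] by (simp add: abs_mult mult_left_le)
    qed
    show "laplacian G (\<lambda>x. \<Sum>\<Pi>\<in>E. c \<Pi> * h \<Pi> x) x = 0" for x
      unfolding laplacian_sum using h(2) by simp
  qed (use c(2) inf in auto)
  then show False
    using h(3)[of c] c(1) by blast
qed

text \<open>
  The empty set has to be avoided here: relative to it an infinite graph is always a non-parabolic
  end, because the boundary condition is void.
\<close>

lemma num_nonparabolic_ends_eq:
  "num_nonparabolic_ends G =
    (SUP \<Omega>\<in>{\<Omega>. finite \<Omega> \<and> \<Omega> \<noteq> {}}. num_nonparabolic_ends_wrt G \<Omega>)"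
proof -
  let ?N = "num_nonparabolic_ends_wrt G"
  let ?sup = "SUP \<Omega>\<in>{\<Omega>. finite \<Omega> \<and> \<Omega> \<noteq> {}}. ?N \<Omega>"
  have lim: "(\<lambda>i. ?N (\<Omega> i)) \<longlonglongrightarrow> ?sup" if ex: "exhaustion \<Omega>" for \<Omega>
  proof -
    have inc: "incseq \<Omega>" and fin: "\<And>i. finite (\<Omega> i)" and cover: "(\<Union>i. \<Omega> i) = UNIV"
      using ex by (auto simp: exhaustion_def)
    have absorb: "eventually (\<lambda>i. S \<subseteq> \<Omega> i) sequentially" if "finite S" for S
      using that
    proof (induction rule: finite_induct)
      case (insert x S)
      have "x \<in> (\<Union>i. \<Omega> i)"
        using cover by simp
      then obtain n where "x \<in> \<Omega> n"
        by blast
      then have "eventually (\<lambda>i. x \<in> \<Omega> i) sequentially"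
        unfolding eventually_sequentially using inc by (auto simp: incseq_def)
      then show ?case
        using insert.IH by eventually_elim auto
    qed auto
    show ?thesis
    proof (rule order_tendstoI)
      fix a assume "a < ?sup"
      then obtain S where S: "finite S" "S \<noteq> {}" "a < ?N S"
        by (auto simp: less_SUP_iff)
      show "eventually (\<lambda>i. a < ?N (\<Omega> i)) sequentially"
        using absorb[OF S(1)]
      proof eventually_elim
        case (elim i)
        show ?case
          using S(3) num_nonparabolic_ends_wrt_mono[OF S(2) elim fin] by simp
      qed
    next
      fix a assume a: "?sup < a"
      have "eventually (\<lambda>i. {undefined} \<subseteq> \<Omega> i) sequentially"
        by (rule absorb) simp
      then show "eventually (\<lambda>i. ?N (\<Omega> i) < a) sequentially"
      proof eventually_elim
        case (elim i)
        have "?N (\<Omega> i) \<le> ?sup"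
          using elim fin by (intro SUP_upper) auto
        then show ?case
          using a by simp
      qed
    qed
  qed
  have balls: "exhaustion (graph_ball G undefined)"
    using finite_graph_ball by (auto simp: exhaustion_def incseq_def graph_ball_def)
  show ?thesis
    unfolding num_nonparabolic_ends_def
  proof (rule the_equality)
    show "\<forall>\<Omega>. exhaustion \<Omega> \<longrightarrow> (\<lambda>i. ?N (\<Omega> i)) \<longlonglongrightarrow> ?sup"
      using lim by blast
    show "N = ?sup" if "\<forall>\<Omega>. exhaustion \<Omega> \<longrightarrow> (\<lambda>i. ?N (\<Omega> i)) \<longlonglongrightarrow> N" for N
      using LIMSEQ_unique lim[OF balls] that balls by blast
  qed
qed

end

lemma bounded_geometry_imp_bounded_wgraph:
  assumes "weighted_graph G" and "bounded_geometry G"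
  shows "\<exists>A. bounded_wgraph G A"
proof -
  obtain C where C: "0 < C" "\<And>x. real (degree G x) \<le> C" "\<And>x. inverse C \<le> vweight G x"
    "\<And>x. vweight G x \<le> C" "\<And>x y. adj G x y \<Longrightarrow> inverse C \<le> eweight G x y"
    "\<And>x y. adj G x y \<Longrightarrow> eweight G x y \<le> C"
    using assms(2) by (auto simp: bounded_geometry_def)
  have "inverse C \<le> C"
    using C(3,4) order_trans by blast
  then have C1: "1 \<le> C"
    using C(1) by (smt (verit) one_less_inverse)
  have "bounded_wgraph G (C * C)"
  proof
    show "weighted_graph G"
      by (rule assms)
    show "1 \<le> C * C"
      using mult_mono[OF C1 C1] C(1) by simp
    fix x
    have "C \<le> C * C"
      using C1 by simp
    then show "real (card {y. adj G x y}) \<le> C * C"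
      using C(2)[of x] by (simp add: degree_def)
    have m: "0 < vweight G x"
      using assms(1) by (simp add: weighted_graph_def)
    fix y assume xy: "adj G x y"
    have w: "0 < eweight G x y"
      using assms(1) xy by (simp add: weighted_graph_def)
    have "eweight G x y / vweight G x \<le> C / inverse C"
      by (rule frac_le) (use C xy w in \<open>auto intro: less_imp_le\<close>)
    then show "eweight G x y / vweight G x \<le> C * C"
      by (simp add: divide_inverse)
    have "inverse C / C \<le> eweight G x y / vweight G x"
      by (rule frac_le) (use C xy w m in \<open>auto intro: less_imp_le\<close>)
    then show "1 / (C * C) \<le> eweight G x y / vweight G x"
      by (simp add: divide_inverse)
  qed
  then show ?thesis ..
qed

theorem corollary1p4:
  fixes G :: "'v wgraph" and x0 :: 'v and R0 :: nat
  assumes "weighted_graph G"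
    and "bounded_geometry G"
    and "CD_0_inf_outside G (graph_ball G x0 R0) \<or>
         nonneg_ollivier_outside G (graph_ball G x0 R0)"
  shows "num_nonparabolic_ends G \<le> enat (card (graph_sphere G x0 (R0 + 1)))"
proof -
  obtain A where "bounded_wgraph G A"
    using bounded_geometry_imp_bounded_wgraph[OF assms(1,2)] by blast
  then interpret bounded_wgraph G A .
  show ?thesis
    unfolding num_nonparabolic_ends_eq
    by (rule SUP_least) (rule num_nonparabolic_ends_wrt_le[OF assms(3)])
qed

end
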